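(* Let $\boldsymbol\rho_h,\boldsymbol u_h^x,\boldsymbol u_h^y\in\boldsymbol V_h$ be obtained from the two-dimensional semi-discrete scheme described in the context, and let $E_h=\widetilde{\int_J}\widetilde{\int_I}e(\boldsymbol\rho_h)\,dx\,dy$ be the discrete entropy. (1) Suppose central and Lax–Friedrichs fluxes are used. Then $$\frac{d}{dt}E_h=-\widetilde{\int_J}\widetilde{\int_I}\left(\boldsymbol u_h^x\cdot F_h\boldsymbol u_h^x+\boldsymbol u_h^y\cdot F_h\boldsymbol u_h^y\right)dx\,dy-\frac12\sum_{i=1}^{N^x}\widetilde{\int_J}\alpha^x_{i+\frac12}(y)\,[\boldsymbol\xi_h]_{i+\frac12}(y)\cdot[\boldsymbol\rho_h]_{i+\frac12}(y)\,dy-\frac12\sum_{j=1}^{N^y}\widetilde{\int_I}\alpha^y_{j+\frac12}(x)\,[\boldsymbol\xi_h]_{j+\frac12}(x)\cdot[\boldsymbol\rho_h]_{j+\frac12}(x)\,dx\le0.$$ (2) Suppose alternating fluxes are used. Then $$\frac{d}{dt}E_h=-\widetilde{\int_J}\widetilde{\int_I}\left(\boldsymbol u_h^x\cdot F_h\boldsymbol u_h^x+\boldsymbol u_h^y\cdot F_h\boldsymbol u_h^y\right)dx\,dy\le0.$$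
   Context: **Continuous problem.** On a rectangle $\Omega=I\times J$ consider $\partial_t\boldsymbol\rho=\partial_x(F(\boldsymbol\rho)\partial_x\boldsymbol\xi(\boldsymbol\rho))+\partial_y(F(\boldsymbol\rho)\partial_y\boldsymbol\xi(\boldsymbol\rho))$ for $\boldsymbol\rho=(\rho_1,\dots,\rho_m)^T$. Here $e=e(\boldsymbol\rho)$ is a scalar-valued twice differentiable convex function, $\boldsymbol\xi=(\partial_{\rho_1}e,\dots,\partial_{\rho_m}e)^T$, and $F(\boldsymbol\rho)$ is an $m\times m$ matrix, possibly non-symmetric, positive semidefinite in the sense $\boldsymbol z\cdot F\boldsymbol z\ge0$ for all $\boldsymbol z\in\mathbb R^m$. The functions $e,\boldsymbol\xi,F$ are defined on a convex set of states in which $\boldsymbol\rho_h$ takes its values. The periodic boundary condition (or compact support, treated in the same way) is assumed: opposite sides of $\Omega$ are identified. **Mesh and space.** A regular Cartesian mesh: $I=\bigcup_{i=1}^{N^x}I_i$, $I_i=(x_{i-\frac12},x_{i+\frac12})$, $J=\bigcup_{j=1}^{N^y}J_j$, $J_j=(y_{j-\frac12},y_{j+\frac12})$, $h_i^x=x_{i+\frac12}-x_{i-\frac12}$, $h_j^y=y_{j+\frac12}-y_{j-\frac12}$. For $k\ge1$, $V_h=\{v_h: v_h|_{I_i\times J_j}\in Q^k(I_i\times J_j)\ \forall i,j\}$, where $Q^k(I_i\times J_j)$ is the tensor product of $P^k(I_i)$ and $P^k(J_j)$ ($P^k$: polynomials of degree at most $k$), and $\boldsymbol V_h=\prod_{l=1}^mV_h$.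 Superscripts $\pm$ on an interface coordinate denote one-sided limits, and $$\{\boldsymbol v\}_{i+\frac12}(y)=\tfrac12(\boldsymbol v(x_{i+\frac12}^+,y)+\boldsymbol v(x_{i+\frac12}^-,y)),\quad[\boldsymbol v]_{i+\frac12}(y)=\boldsymbol v(x_{i+\frac12}^+,y)-\boldsymbol v(x_{i+\frac12}^-,y),$$ and similarly $\{\boldsymbol v\}_{j+\frac12}(x)$, $[\boldsymbol v]_{j+\frac12}(x)$ with respect to $y_{j+\frac12}^\pm$. **Quadrature.** $\widetilde{\int_{I_i}}\cdot\,dx$ and $\widetilde{\int_{J_j}}\cdot\,dy$ denote the $(k+1)$-point Gauss–Lobatto quadrature rules on $I_i$ and $J_j$ (endpoints included, with one-sided limits from inside the cell), e.g. $\widetilde{\int_{I_i}}f\,dx=\frac{h_i^x}{2}\sum_{r=1}^{k+1}w_rf(x_i^r)$ with $w_r$ the weights on $[-1,1]$. Whenever a derivative $\partial_x\boldsymbol\psi$ or $\partial_y\boldsymbol\psi$ appears in a quadrature, $\boldsymbol\psi$ is first replaced by its componentwise degree-$k$ (tensor-product) interpolation polynomial at the Gauss–Lobatto points of the cell. $\widetilde{\int_I}\cdot\,dx=\sum_{i=1}^{N^x}\widetilde{\int_{I_i}}\cdot\,dx$, $\widetilde{\int_J}\cdot\,dy=\sum_{j=1}^{N^y}\widetilde{\int_{J_j}}\cdot\,dy$. **Semi-discrete scheme.** With $F_h=F(\boldsymbol\rho_h)$, $\boldsymbol\xi_h=\boldsymbol\xi(\boldsymbol\rho_h)$, find $\boldsymbol\rho_h,\boldsymbol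 u_h^x,\boldsymbol u_h^y\in\boldsymbol V_h$ ($\boldsymbol\rho_h$ differentiable in $t$) such that for all $\boldsymbol\varphi_h,\boldsymbol\psi_h^x,\boldsymbol\psi_h^y\in\boldsymbol V_h$ and all $i,j$: $$\begin{aligned}\widetilde{\int_{J_j}}\widetilde{\int_{I_i}}\partial_t\boldsymbol\rho_h\cdot\boldsymbol\varphi_h\,dxdy=&-\widetilde{\int_{J_j}}\widetilde{\int_{I_i}}\left(F_h\boldsymbol u_h^x\cdot\partial_x\boldsymbol\varphi_h+F_h\boldsymbol u_h^y\cdot\partial_y\boldsymbol\varphi_h\right)dxdy\\&+\widetilde{\int_{J_j}}\left(\widehat{F\boldsymbol u^x}_{i+\frac12}(y)\cdot\boldsymbol\varphi_h(x_{i+\frac12}^-,y)-\widehat{F\boldsymbol u^x}_{i-\frac12}(y)\cdot\boldsymbol\varphi_h(x_{i-\frac12}^+,y)\right)dy\\&+\widetilde{\int_{I_i}}\left(\widehat{F\boldsymbol u^y}_{j+\frac12}(x)\cdot\boldsymbol\varphi_h(x,y_{j+\frac12}^-)-\widehat{F\boldsymbol u^y}_{j-\frac12}(x)\cdot\boldsymbol\varphi_h(x,y_{j-\frac12}^+)\right)dx,\end{aligned}$$ $$\begin{aligned}\widetilde{\int_{J_j}}\widetilde{\int_{I_i}}\left(\boldsymbol u_h^x\cdot\boldsymbol\psi_h^x+\boldsymbol u_h^y\cdot\boldsymbol\psi_h^y\right)dxdy=&-\widetilde{\int_{J_j}}\widetilde{\int_{I_i}}\boldsymbol\xi_h\cdot(\partial_x\boldsymbol\psi_h^x+\partial_y\boldsymbol\psi_h^y)\,dxdy\\&+\widetilde{\int_{J_j}}\left(\widehat{\boldsymbol\xi}_{i+\frac12}(y)\cdot\boldsymbol\psi_h^x(x_{i+\frac12}^-,y)-\widehat{\boldsymbol\xi}_{i-\frac12}(y)\cdot\boldsymbol\psi_h^x(x_{i-\frac12}^+,y)\right)dy\\&+\widetilde{\int_{I_i}}\left(\widehat{\boldsymbol\xi}_{j+\frac12}(x)\cdot\boldsymbol\psi_h^y(x,y_{j+\frac12}^-)-\widehat{\boldsymbol\xi}_{j-\frac12}(x)\cdot\boldsymbol\psi_h^y(x,y_{j-\frac12}^+)\right)dx.\end{aligned}$$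 **Numerical fluxes.** - Central and Lax–Friedrichs fluxes: $\widehat{\boldsymbol\xi}_{i+\frac12}(y)=\{\boldsymbol\xi_h\}_{i+\frac12}(y)$, $\widehat{\boldsymbol\xi}_{j+\frac12}(x)=\{\boldsymbol\xi_h\}_{j+\frac12}(x)$, $$\widehat{F\boldsymbol u^x}_{i+\frac12}(y)=\left(\{F_h\boldsymbol u_h^x\}_{i+\frac12}+\tfrac{\alpha^x_{i+\frac12}}{2}[\boldsymbol\rho_h]_{i+\frac12}\right)(y),\quad\alpha^x_{i+\frac12}(y)=\max(|\boldsymbol v_h^x(x_{i+\frac12}^+,y)|_\infty,|\boldsymbol v_h^x(x_{i+\frac12}^-,y)|_\infty),$$ $$\widehat{F\boldsymbol u^y}_{j+\frac12}(x)=\left(\{F_h\boldsymbol u_h^y\}_{j+\frac12}+\tfrac{\alpha^y_{j+\frac12}}{2}[\boldsymbol\rho_h]_{j+\frac12}\right)(x),\quad\alpha^y_{j+\frac12}(x)=\max(|\boldsymbol v_h^y(x,y_{j+\frac12}^+)|_\infty,|\boldsymbol v_h^y(x,y_{j+\frac12}^-)|_\infty),$$ with $\boldsymbol v_h^x=\mathrm{diag}(\boldsymbol\rho_h)^{-1}F_h\boldsymbol u_h^x$, $\boldsymbol v_h^y=\mathrm{diag}(\boldsymbol\rho_h)^{-1}F_h\boldsymbol u_h^y$, and $|\cdot|_\infty$ the $\ell^\infty$ norm on $\mathbb R^m$. For this choice $\mathrm{diag}(\boldsymbol\rho)^{-1}F(\boldsymbol\rho)$ is assumed bounded so that these are well-defined.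 - Alternating fluxes: $\widehat{\boldsymbol\xi}_{i+\frac12}(y)=\boldsymbol\xi_h(x_{i+\frac12}^\mp,y)$, $\widehat{F\boldsymbol u^x}_{i+\frac12}(y)=(F_h\boldsymbol u_h^x)(x_{i+\frac12}^\pm,y)$, $\widehat{\boldsymbol\xi}_{j+\frac12}(x)=\boldsymbol\xi_h(x,y_{j+\frac12}^\mp)$, $\widehat{F\boldsymbol u^y}_{j+\frac12}(x)=(F_h\boldsymbol u_h^y)(x,y_{j+\frac12}^\pm)$, where in each direction the same sign choice (upper or lower) is used at all interfaces. *)

theory Defs
  imports "HOL-Analysis.Analysis" "HOL-Computational_Algebra.Polynomial"
begin

section \<open>Gauss--Lobatto quadrature\<close>

text \<open>Rodrigues' formula.\<close>
definition legendre :: "nat \<Rightarrow> real poly" where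
  "legendre k = smult (1 / (2 ^ k * fact k)) ((pderiv ^^ k) ([:-1, 0, 1:] ^ k))"

text \<open>The \<open>k + 1\<close> Gauss--Lobatto points on \<open>[-1, 1]\<close> are the roots of
  \<open>(1 - x\<^sup>2) P'\<^sub>k(x)\<close>. They are numbered in increasing order as \<open>r = 0, \<dots>, k\<close>; the
  weights are those of the interpolatory rule.\<close>
definition gl_node :: "nat \<Rightarrow> nat \<Rightarrow> real" where
  "gl_node k r = sorted_list_of_set {x. poly ([:1, 0, -1:] * pderiv (legendre k)) x = 0} ! r"

definition lagrange_basis :: "nat \<Rightarrow> nat \<Rightarrow> real \<Rightarrow> real" where
  "lagrange_basis k r x = (\<Prod>s\<in>{..k} - {r}. (x - gl_node k s) / (gl_node k r - gl_node k s))"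

definition gl_weight :: "nat \<Rightarrow> nat \<Rightarrow> real" where
  "gl_weight k r = integral {-1..1} (lagrange_basis k r)"


section \<open>Mesh\<close>

text \<open>A partition of an interval into cells \<open>1, \<dots>, ncells\<close>; cell \<open>i\<close> is
  \<open>(gridpt (i - 1), gridpt i)\<close>, that is, \<open>gridpt i\<close> is the interface \<open>x\<^bsub>i+1/2\<^esub>\<close>.\<close>
record mesh1d =
  ncells :: nat
  gridpt :: "nat \<Rightarrow> real"

definition is_mesh :: "mesh1d \<Rightarrow> bool" where
  "is_mesh X \<longleftrightarrow> 1 \<le> ncells X \<and> (\<forall>i<ncells X. gridpt X i < gridpt X (Suc i))"

definition lpt :: "mesh1d \<Rightarrow> nat \<Rightarrow> real" where
  "lpt X i = gridpt X (i - 1)"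

definition rpt :: "mesh1d \<Rightarrow> nat \<Rightarrow> real" where
  "rpt X i = gridpt X i"

definition cell_width :: "mesh1d \<Rightarrow> nat \<Rightarrow> real" where
  "cell_width X i = rpt X i - lpt X i"

definition cell_node :: "nat \<Rightarrow> mesh1d \<Rightarrow> nat \<Rightarrow> nat \<Rightarrow> real" where
  "cell_node k X i r = (lpt X i + rpt X i) / 2 + cell_width X i / 2 * gl_node k r"

definition cell_basis :: "nat \<Rightarrow> mesh1d \<Rightarrow> nat \<Rightarrow> nat \<Rightarrow> real \<Rightarrow> real" where
  "cell_basis k X i r x = lagrange_basis k r ((2 * x - lpt X i - rpt X i) / cell_width X i)"

definition cell_quad :: "nat \<Rightarrow> mesh1d \<Rightarrow> nat \<Rightarrow> (real \<Rightarrow> real) \<Rightarrow> real" where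
  "cell_quad k X i f = cell_width X i / 2 * (\<Sum>r\<le>k. gl_weight k r * f (cell_node k X i r))"

text \<open>The integrand of a quadrature over the whole interval has one branch per cell, because the
  value used at a cell endpoint is the one-sided limit from inside that cell.\<close>
definition mesh_quad :: "nat \<Rightarrow> mesh1d \<Rightarrow> (nat \<Rightarrow> real \<Rightarrow> real) \<Rightarrow> real" where
  "mesh_quad k X f = (\<Sum>i=1..ncells X. cell_quad k X i (f i))"

text \<open>Cells to the left and to the right of interface \<open>i + 1/2\<close>, \<open>0 \<le> i \<le> ncells\<close>. By
  periodicity the interfaces \<open>1/2\<close> and \<open>ncells + 1/2\<close> both separate cell \<open>ncells\<close> from
  cell \<open>1\<close>.\<close>
definition lcell :: "mesh1d \<Rightarrow> nat \<Rightarrow> nat" where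
  "lcell X i = (if i = 0 then ncells X else i)"

definition rcell :: "mesh1d \<Rightarrow> nat \<Rightarrow> nat" where
  "rcell X i = (if i = ncells X then 1 else Suc i)"


section \<open>Piecewise functions on the tensor product mesh\<close>

text \<open>A function that is two-valued on the cell interfaces is given by its branches: \<open>v i j\<close> is
  the restriction to the cell \<open>I\<^sub>i \<times> J\<^sub>j\<close>, extended continuously to the closed cell. One-sided
  limits at an interface are therefore values of the branch on the corresponding side.\<close>
type_synonym 'm pw_fun = "nat \<Rightarrow> nat \<Rightarrow> real \<Rightarrow> real \<Rightarrow> real ^ 'm"

definition dg_space :: "nat \<Rightarrow> mesh1d \<Rightarrow> mesh1d \<Rightarrow> ('m::finite) pw_fun set" where
  "dg_space k X Y = {v. \<forall>i\<in>{1..ncells X}. \<forall>j\<in>{1..ncells Y}. \<forall>l. \<exists>c :: nat \<Rightarrow> nat \<Rightarrow> real.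
     \<forall>x\<in>{lpt X i..rpt X i}. \<forall>y\<in>{lpt Y j..rpt Y j}.
       v i j x y $ l = (\<Sum>a\<le>k. \<Sum>b\<le>k. c a b * x ^ a * y ^ b)}"

definition gl_interp :: "nat \<Rightarrow> mesh1d \<Rightarrow> mesh1d \<Rightarrow> ('m::finite) pw_fun \<Rightarrow> 'm pw_fun" where
  "gl_interp k X Y v i j x y =
     (\<Sum>r\<le>k. \<Sum>s\<le>k. (cell_basis k X i r x * cell_basis k Y j s y) *\<^sub>R
        v i j (cell_node k X i r) (cell_node k Y j s))"

text \<open>Inside a quadrature a function is interpolated before it is differentiated.\<close>
definition qdx :: "nat \<Rightarrow> mesh1d \<Rightarrow> mesh1d \<Rightarrow> ('m::finite) pw_fun \<Rightarrow> 'm pw_fun" where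
  "qdx k X Y v i j x y = vector_derivative (\<lambda>x'. gl_interp k X Y v i j x' y) (at x)"

definition qdy :: "nat \<Rightarrow> mesh1d \<Rightarrow> mesh1d \<Rightarrow> ('m::finite) pw_fun \<Rightarrow> 'm pw_fun" where
  "qdy k X Y v i j x y = vector_derivative (\<lambda>y'. gl_interp k X Y v i j x y') (at y)"

definition cell_quad2 ::
  "nat \<Rightarrow> mesh1d \<Rightarrow> mesh1d \<Rightarrow> nat \<Rightarrow> nat \<Rightarrow> (real \<Rightarrow> real \<Rightarrow> real) \<Rightarrow> real" where
  "cell_quad2 k X Y i j f = cell_quad k Y j (\<lambda>y. cell_quad k X i (\<lambda>x. f x y))"

definition mesh_quad2 ::
  "nat \<Rightarrow> mesh1d \<Rightarrow> mesh1d \<Rightarrow> (nat \<Rightarrow> nat \<Rightarrow> real \<Rightarrow> real \<Rightarrow> real) \<Rightarrow> real" where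
  "mesh_quad2 k X Y f = mesh_quad k Y (\<lambda>j y. mesh_quad k X (\<lambda>i x. f i j x y))"

text \<open>Traces at the vertical interfaces (\<open>i\<close> an interface, \<open>j\<close> a cell) and at the horizontal
  ones (\<open>i\<close> a cell, \<open>j\<close> an interface): limits from the left/below (\<open>m\<close>) and from the
  right/above (\<open>p\<close>).\<close>
definition xm :: "mesh1d \<Rightarrow> ('m::finite) pw_fun \<Rightarrow> nat \<Rightarrow> nat \<Rightarrow> real \<Rightarrow> real ^ 'm" where
  "xm X v i j y = v (lcell X i) j (rpt X (lcell X i)) y"

definition xp :: "mesh1d \<Rightarrow> ('m::finite) pw_fun \<Rightarrow> nat \<Rightarrow> nat \<Rightarrow> real \<Rightarrow> real ^ 'm" where
  "xp X v i j y = v (rcell X i) j (lpt X (rcell X i)) y"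

definition ym :: "mesh1d \<Rightarrow> ('m::finite) pw_fun \<Rightarrow> nat \<Rightarrow> nat \<Rightarrow> real \<Rightarrow> real ^ 'm" where
  "ym Y v i j x = v i (lcell Y j) x (rpt Y (lcell Y j))"

definition yp :: "mesh1d \<Rightarrow> ('m::finite) pw_fun \<Rightarrow> nat \<Rightarrow> nat \<Rightarrow> real \<Rightarrow> real ^ 'm" where
  "yp Y v i j x = v i (rcell Y j) x (lpt Y (rcell Y j))"

definition avg_x :: "mesh1d \<Rightarrow> ('m::finite) pw_fun \<Rightarrow> nat \<Rightarrow> nat \<Rightarrow> real \<Rightarrow> real ^ 'm" where
  "avg_x X v i j y = (1 / 2) *\<^sub>R (xp X v i j y + xm X v i j y)"

definition avg_y :: "mesh1d \<Rightarrow> ('m::finite) pw_fun \<Rightarrow> nat \<Rightarrow> nat \<Rightarrow> real \<Rightarrow> real ^ 'm" where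
  "avg_y Y v i j x = (1 / 2) *\<^sub>R (yp Y v i j x + ym Y v i j x)"

definition jump_x :: "mesh1d \<Rightarrow> ('m::finite) pw_fun \<Rightarrow> nat \<Rightarrow> nat \<Rightarrow> real \<Rightarrow> real ^ 'm" where
  "jump_x X v i j y = xp X v i j y - xm X v i j y"

definition jump_y :: "mesh1d \<Rightarrow> ('m::finite) pw_fun \<Rightarrow> nat \<Rightarrow> nat \<Rightarrow> real \<Rightarrow> real ^ 'm" where
  "jump_y Y v i j x = yp Y v i j x - ym Y v i j x"


section \<open>Entropy variable and coefficient matrix\<close>

text \<open>\<open>\<xi> = (\<partial>\<^bsub>\<rho>\<^sub>1\<^esub>e, \<dots>, \<partial>\<^bsub>\<rho>\<^sub>m\<^esub>e)\<close>. The derivative is taken within the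
  state set, which need not be open.\<close>
definition entropy_var ::
  "(real ^ 'm \<Rightarrow> real) \<Rightarrow> (real ^ 'm) set \<Rightarrow> real ^ 'm \<Rightarrow> real ^ ('m::finite)" where
  "entropy_var e D \<rho> = (\<chi> l. frechet_derivative e (at \<rho> within D) (axis l 1))"

definition diag_matrix :: "real ^ 'm \<Rightarrow> real ^ 'm ^ ('m::finite)" where
  "diag_matrix p = (\<chi> a b. if a = b then p $ a else 0)"

definition at_states :: "(real ^ 'm \<Rightarrow> real ^ 'm) \<Rightarrow> 'm pw_fun \<Rightarrow> ('m::finite) pw_fun" where
  "at_states \<xi> \<rho> i j x y = \<xi> (\<rho> i j x y)"

definition mat_app ::
  "(real ^ 'm \<Rightarrow> real ^ 'm ^ 'm) \<Rightarrow> 'm pw_fun \<Rightarrow> 'm pw_fun \<Rightarrow> ('m::finite) pw_fun" where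
  "mat_app F \<rho> u i j x y = F (\<rho> i j x y) *v u i j x y"


section \<open>The semi-discrete scheme\<close>

text \<open>The scheme at one instant. The argument \<open>\<rho>t\<close> is the time derivative of \<open>\<rho>\<close>; the arguments
  \<open>Fux\<close>, \<open>Fuy\<close>, \<open>\<xi>x\<close>, \<open>\<xi>y\<close> are the numerical fluxes at the vertical (\<open>x\<close>) and
  horizontal (\<open>y\<close>) interfaces.\<close>
definition dg_scheme ::
  "nat \<Rightarrow> mesh1d \<Rightarrow> mesh1d \<Rightarrow> (real ^ 'm \<Rightarrow> real ^ 'm ^ 'm) \<Rightarrow> (real ^ 'm \<Rightarrow> real ^ 'm)
   \<Rightarrow> (nat \<Rightarrow> nat \<Rightarrow> real \<Rightarrow> real ^ 'm) \<Rightarrow> (nat \<Rightarrow> nat \<Rightarrow> real \<Rightarrow> real ^ 'm)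
   \<Rightarrow> (nat \<Rightarrow> nat \<Rightarrow> real \<Rightarrow> real ^ 'm) \<Rightarrow> (nat \<Rightarrow> nat \<Rightarrow> real \<Rightarrow> real ^ 'm)
   \<Rightarrow> 'm pw_fun \<Rightarrow> 'm pw_fun \<Rightarrow> 'm pw_fun \<Rightarrow> ('m::finite) pw_fun \<Rightarrow> bool" where
  "dg_scheme k X Y F \<xi> Fux Fuy \<xi>x \<xi>y \<rho>t \<rho> ux uy \<longleftrightarrow>
    (\<forall>\<phi>\<in>dg_space k X Y. \<forall>i\<in>{1..ncells X}. \<forall>j\<in>{1..ncells Y}.
      cell_quad2 k X Y i j (\<lambda>x y. \<rho>t i j x y \<bullet> \<phi> i j x y) =
      - cell_quad2 k X Y i j (\<lambda>x y.
            mat_app F \<rho> ux i j x y \<bullet> qdx k X Y \<phi> i j x y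
          + mat_app F \<rho> uy i j x y \<bullet> qdy k X Y \<phi> i j x y)
      + cell_quad k Y j (\<lambda>y.
            Fux i j y \<bullet> \<phi> i j (rpt X i) y - Fux (i - 1) j y \<bullet> \<phi> i j (lpt X i) y)
      + cell_quad k X i (\<lambda>x.
            Fuy i j x \<bullet> \<phi> i j x (rpt Y j) - Fuy i (j - 1) x \<bullet> \<phi> i j x (lpt Y j))) \<and>
    (\<forall>\<psi>x\<in>dg_space k X Y. \<forall>\<psi>y\<in>dg_space k X Y. \<forall>i\<in>{1..ncells X}. \<forall>j\<in>{1..ncells Y}.
      cell_quad2 k X Y i j (\<lambda>x y. ux i j x y \<bullet> \<psi>x i j x y + uy i j x y \<bullet> \<psi>y i j x y) =
      - cell_quad2 k X Y i j (\<lambda>x y.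
            at_states \<xi> \<rho> i j x y \<bullet> (qdx k X Y \<psi>x i j x y + qdy k X Y \<psi>y i j x y))
      + cell_quad k Y j (\<lambda>y.
            \<xi>x i j y \<bullet> \<psi>x i j (rpt X i) y - \<xi>x (i - 1) j y \<bullet> \<psi>x i j (lpt X i) y)
      + cell_quad k X i (\<lambda>x.
            \<xi>y i j x \<bullet> \<psi>y i j x (rpt Y j) - \<xi>y i (j - 1) x \<bullet> \<psi>y i j x (lpt Y j)))"

text \<open>In the following definitions \<open>G\<close> stands for \<open>diag(\<rho>)\<^sup>-\<^sup>1 F(\<rho>)\<close>; \<open>infnorm\<close> is the
  maximum norm on the coordinates. Keeping \<open>G\<close> as a function with \<open>diag(\<rho>) G(\<rho>) = F(\<rho>)\<close> allows a
  bounded extension to states with a vanishing component.\<close>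
definition alpha_x ::
  "mesh1d \<Rightarrow> (real ^ 'm \<Rightarrow> real ^ 'm ^ 'm) \<Rightarrow> 'm pw_fun \<Rightarrow> ('m::finite) pw_fun
   \<Rightarrow> nat \<Rightarrow> nat \<Rightarrow> real \<Rightarrow> real" where
  "alpha_x X G \<rho> ux i j y =
     max (infnorm (xp X (mat_app G \<rho> ux) i j y)) (infnorm (xm X (mat_app G \<rho> ux) i j y))"

definition alpha_y ::
  "mesh1d \<Rightarrow> (real ^ 'm \<Rightarrow> real ^ 'm ^ 'm) \<Rightarrow> 'm pw_fun \<Rightarrow> ('m::finite) pw_fun
   \<Rightarrow> nat \<Rightarrow> nat \<Rightarrow> real \<Rightarrow> real" where
  "alpha_y Y G \<rho> uy i j x =
     max (infnorm (yp Y (mat_app G \<rho> uy) i j x)) (infnorm (ym Y (mat_app G \<rho> uy) i j x))"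

definition lf_flux_x ::
  "mesh1d \<Rightarrow> (real ^ 'm \<Rightarrow> real ^ 'm ^ 'm) \<Rightarrow> (real ^ 'm \<Rightarrow> real ^ 'm ^ 'm)
   \<Rightarrow> 'm pw_fun \<Rightarrow> ('m::finite) pw_fun \<Rightarrow> nat \<Rightarrow> nat \<Rightarrow> real \<Rightarrow> real ^ 'm" where
  "lf_flux_x X F G \<rho> ux i j y =
     avg_x X (mat_app F \<rho> ux) i j y + (alpha_x X G \<rho> ux i j y / 2) *\<^sub>R jump_x X \<rho> i j y"

definition lf_flux_y ::
  "mesh1d \<Rightarrow> (real ^ 'm \<Rightarrow> real ^ 'm ^ 'm) \<Rightarrow> (real ^ 'm \<Rightarrow> real ^ 'm ^ 'm)
   \<Rightarrow> 'm pw_fun \<Rightarrow> ('m::finite) pw_fun \<Rightarrow> nat \<Rightarrow> nat \<Rightarrow> real \<Rightarrow> real ^ 'm" where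
  "lf_flux_y Y F G \<rho> uy i j x =
     avg_y Y (mat_app F \<rho> uy) i j x + (alpha_y Y G \<rho> uy i j x / 2) *\<^sub>R jump_y Y \<rho> i j x"

definition central_lf_scheme ::
  "nat \<Rightarrow> mesh1d \<Rightarrow> mesh1d \<Rightarrow> (real ^ 'm \<Rightarrow> real ^ 'm ^ 'm) \<Rightarrow> (real ^ 'm \<Rightarrow> real ^ 'm ^ 'm)
   \<Rightarrow> (real ^ 'm \<Rightarrow> real ^ 'm)
   \<Rightarrow> 'm pw_fun \<Rightarrow> 'm pw_fun \<Rightarrow> 'm pw_fun \<Rightarrow> ('m::finite) pw_fun \<Rightarrow> bool" where
  "central_lf_scheme k X Y F G \<xi> \<rho>t \<rho> ux uy \<longleftrightarrow>
     dg_scheme k X Y F \<xi> (lf_flux_x X F G \<rho> ux) (lf_flux_y Y F G \<rho> uy)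
       (avg_x X (at_states \<xi> \<rho>)) (avg_y Y (at_states \<xi> \<rho>)) \<rho>t \<rho> ux uy"

text \<open>The Boolean arguments select the upper signs (\<open>\<xi>\<close> from the minus side, \<open>F u\<close> from the plus
  side) or the lower ones, independently in the two directions.\<close>
definition alternating_scheme ::
  "bool \<Rightarrow> bool \<Rightarrow> nat \<Rightarrow> mesh1d \<Rightarrow> mesh1d \<Rightarrow> (real ^ 'm \<Rightarrow> real ^ 'm ^ 'm)
   \<Rightarrow> (real ^ 'm \<Rightarrow> real ^ 'm)
   \<Rightarrow> 'm pw_fun \<Rightarrow> 'm pw_fun \<Rightarrow> 'm pw_fun \<Rightarrow> ('m::finite) pw_fun \<Rightarrow> bool" where
  "alternating_scheme upper_x upper_y k X Y F \<xi> \<rho>t \<rho> ux uy \<longleftrightarrow>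
     dg_scheme k X Y F \<xi>
       ((if upper_x then xp else xm) X (mat_app F \<rho> ux))
       ((if upper_y then yp else ym) Y (mat_app F \<rho> uy))
       ((if upper_x then xm else xp) X (at_states \<xi> \<rho>))
       ((if upper_y then ym else yp) Y (at_states \<xi> \<rho>)) \<rho>t \<rho> ux uy"

definition discrete_entropy ::
  "nat \<Rightarrow> mesh1d \<Rightarrow> mesh1d \<Rightarrow> (real ^ 'm \<Rightarrow> real) \<Rightarrow> ('m::finite) pw_fun \<Rightarrow> real" where
  "discrete_entropy k X Y e \<rho> = mesh_quad2 k X Y (\<lambda>i j x y. e (\<rho> i j x y))"

definition time_deriv ::
  "real set \<Rightarrow> (real \<Rightarrow> ('m::finite) pw_fun) \<Rightarrow> real \<Rightarrow> 'm pw_fun" where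
  "time_deriv T \<rho> t i j x y = vector_derivative (\<lambda>s. \<rho> s i j x y) (at t within T)"

end

theory Submission
  imports Defs
begin

text \<open>Test the first equation with the interpolant of \<open>\<xi>\<^sub>h\<close> and the second one with those of
  \<open>F\<^sub>h u\<^sub>h\<^sup>x\<close> and \<open>F\<^sub>h u\<^sub>h\<^sup>y\<close>. Since the \<open>k + 1\<close> point Gauss--Lobatto rule integrates polynomials
  of degree \<open>2 k - 1\<close> exactly, it satisfies a summation-by-parts formula along every grid line,
  which turns the volume terms into boundary terms; regrouped by interfaces on the periodic mesh,
  these leave only the jump terms of the fluxes. The jump terms have a sign because the gradient
  of a convex function is monotone, and the weights are nonnegative.\<close>


section \<open>Gauss--Lobatto quadrature\<close>

text \<open>Neither \<open>\<xi>(\<rho>)\<close> nor \<open>F(\<rho>) u\<close> is piecewise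
  polynomial, so neither is itself an admissible test function. Passing to interpolants costs
  nothing: the scheme reads test functions only at tensor Gauss--Lobatto points, which include the
  end points where traces are taken, and it interpolates before differentiating. Summation by parts
  is thus a statement on nodal values of arbitrary functions. The degree 2k - 1 is just what it
  takes: the derivative of a product of two polynomials of degree k. The nodes are given as the
  sorted roots of a polynomial, so their number, order and end points have to be established first.
  The fluxes enter the balance only through one interface expression,
  \<open>flux_defect\<close>.\<close>

lemma rolle_roots:
  fixes p :: "real poly"
  assumes "finite S" "S \<noteq> {}" "\<And>x. x \<in> S \<Longrightarrow> poly p x = 0"
  shows "\<exists>R. finite R \<and> card S = Suc (card R) \<and>
           (\<forall>z\<in>R. poly (pderiv p) z = 0 \<and> Min S < z \<and> z < Max S)"
  using assms
proof (induction S rule: finite_linorder_max_induct)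
  case empty
  then show ?case by simp
next
  case (insert b A)
  show ?case
  proof (cases "A = {}")
    case True
    then show ?thesis by (intro exI[of _ "{}"]) auto
  next
    case False
    with insert obtain R where R: "finite R" "card A = Suc (card R)"
      and Rz: "\<And>z. z \<in> R \<Longrightarrow> poly (pderiv p) z = 0 \<and> Min A < z \<and> z < Max A"
      by (metis insertI2)
    have mA: "Max A \<in> A" "Min A \<in> A" using insert False by auto
    then have lt: "Max A < b" "Min A < b" using insert by auto
    \<comment> \<open>Rolle between \<open>Max A\<close> and \<open>b\<close> yields one new zero;
      the strict bound by \<open>Max A\<close> in the induction hypothesis keeps it apart from those
      in \<open>R\<close>.\<close>
    have "\<exists>z>Max A. z < b \<and> b - Max A > 0 \<and> poly p b - poly p (Max A) = (b - Max A) * poly (pderiv p) z"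
      using poly_MVT[OF lt(1), of p] lt by auto
    then obtain z where z: "Max A < z" "z < b" "poly (pderiv p) z = 0"
      using insert.prems mA lt by auto
    have "Min A \<le> Max A" using insert False by simp
    have "Max (insert b A) = b" "Min (insert b A) = Min A"
      using insert(1) False lt by simp_all
    moreover have "Min A < x \<and> x < b \<and> poly (pderiv p) x = 0" if "x \<in> R" for x
      using Rz[OF that] lt by auto
    moreover have "z \<notin> R" using Rz[of z] z by auto
    moreover have "b \<notin> A" using insert(2) by auto
    ultimately have "finite (insert z R) \<and> card (insert b A) = Suc (card (insert z R)) \<and>
        (\<forall>x\<in>insert z R. poly (pderiv p) x = 0 \<and> Min (insert b A) < x \<and> x < Max (insert b A))"
      using R z lt \<open>Min A \<le> Max A\<close> insert(1) by simp
    then show ?thesis by blast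
  qed
qed

lemma power_dvd_pderiv:
  fixes p :: "'a::{idom} poly"
  assumes "q ^ Suc n dvd p"
  shows "q ^ n dvd pderiv p"
proof -
  from assms obtain r where "p = q ^ Suc n * r" by (elim dvdE)
  then have "pderiv p = q ^ Suc n * pderiv r + r * pderiv (q ^ Suc n)"
    by (simp only: pderiv_mult)
  moreover have "q ^ n dvd pderiv (q ^ Suc n)"
    by (auto simp: pderiv_power_Suc simp del: power_Suc of_nat_Suc intro!: dvd_smult)
  moreover have "q ^ n dvd q ^ Suc n" by simp
  ultimately show ?thesis by (metis dvd_add dvd_mult dvd_mult2)
qed

lemma power_dvd_higher_pderiv:
  fixes p :: "'a::{idom} poly"
  assumes "q ^ (n + j) dvd p"
  shows "q ^ n dvd (pderiv ^^ j) p"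
  using assms
proof (induction j arbitrary: n)
  case (Suc j)
  have "q ^ Suc n dvd (pderiv ^^ j) p" using Suc.prems by (intro Suc.IH) simp
  then show ?case by (simp add: power_dvd_pderiv del: power_Suc)
qed simp

lemma degree_higher_pderiv:
  "degree ((pderiv ^^ j) (p :: real poly)) = degree p - j"
  by (induction j) (simp_all add: degree_pderiv)

text \<open>The derivatives between (x^2 - 1)^k and a multiple of the Legendre polynomial: counting
  zeros and proving orthogonality both proceed one derivative at a time.\<close>

definition rodrigues :: "nat \<Rightarrow> nat \<Rightarrow> real poly" where
  "rodrigues k j = (pderiv ^^ j) ([:-1, 0, 1:] ^ k)"

lemma rodrigues_Suc: "rodrigues k (Suc j) = pderiv (rodrigues k j)"
  by (simp add: rodrigues_def)

lemma degree_rodrigues: "degree (rodrigues k j) = 2 * k - j"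
  by (simp add: rodrigues_def degree_higher_pderiv degree_power_eq)

lemma legendre_rodrigues: "legendre k = smult (1 / (2 ^ k * fact k)) (rodrigues k k)"
  by (simp add: legendre_def rodrigues_def)

text \<open>The end points are zeros of order k of (x^2 - 1)^k, and each derivative lowers the order
  by at most one. This removes the boundary terms in \<open>integral_rodrigues\<close>.\<close>

lemma rodrigues_endpoints:
  assumes "j < k" "x = 1 \<or> x = -1"
  shows "poly (rodrigues k j) x = 0"
proof -
  have "[:-x, 1:] ^ (k - j + j) dvd [:-1, 0, 1:] ^ k"
  proof -
    have "[:-x, 1:] dvd [:-1, 0, 1:]" using assms(2) by (auto simp flip: poly_eq_0_iff_dvd)
    then show ?thesis using assms(1) by (simp add: dvd_power_same)
  qed
  then have "[:-x, 1:] ^ (k - j) dvd rodrigues k j"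
    unfolding rodrigues_def by (rule power_dvd_higher_pderiv)
  moreover have "[:-x, 1:] dvd [:-x, 1:] ^ (k - j)" using assms(1) by (intro dvd_power) simp
  ultimately show ?thesis by (metis dvd_trans poly_eq_0_iff_dvd)
qed

text \<open>The j inner zeros together with -1 and 1 are j + 2 zeros, between which Rolle's theorem
  finds j + 1 zeros of the next derivative.\<close>

lemma rodrigues_roots:
  assumes "j \<le> k"
  shows "\<exists>R. finite R \<and> card R = j \<and> R \<subseteq> {-1<..<1} \<and> (\<forall>z\<in>R. poly (rodrigues k j) z = 0)"
  using assms
proof (induction j)
  case 0
  then show ?case by auto
next
  case (Suc j)
  then obtain R where R: "finite R" "card R = j" "R \<subseteq> {-1<..<1}" "\<And>z. z \<in> R \<Longrightarrow> poly (rodrigues k j) z = 0"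
    by auto
  define S where "S = insert 1 (insert (-1) R)"
  have "\<And>x. x \<in> S \<Longrightarrow> poly (rodrigues k j) x = 0"
    using R(4) rodrigues_endpoints[of j k] Suc.prems by (auto simp: S_def)
  then obtain Q where Q: "finite Q" "card S = Suc (card Q)"
      "\<And>z. z\<in>Q \<Longrightarrow> poly (rodrigues k (Suc j)) z = 0 \<and> Min S < z \<and> z < Max S"
    using rolle_roots[of S "rodrigues k j"] R(1) by (auto simp: S_def rodrigues_Suc)
  have "card S = Suc (Suc j)" using R by (auto simp: S_def card_insert_if)
  moreover have "Min S = -1" "Max S = 1"
  proof -
    have "x \<in> S \<Longrightarrow> -1 \<le> x \<and> x \<le> 1" for x using R(3) by (auto simp: S_def dest!: subsetD)
    then show "Min S = -1" "Max S = 1"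
      using R(1) by (auto intro!: Min_eqI Max_eqI) (auto simp: S_def)
  qed
  ultimately show ?case using Q by (intro exI[of _ Q]) auto
qed

abbreviation lobatto_poly :: "nat \<Rightarrow> real poly" where
  "lobatto_poly k \<equiv> [:1, 0, -1:] * pderiv (legendre k)"

lemma degree_legendre: "degree (legendre k) = k"
  by (simp add: legendre_rodrigues degree_rodrigues)

lemma degree_lobatto_poly:
  assumes "k \<ge> 1"
  shows "degree (lobatto_poly k) = Suc k" "lobatto_poly k \<noteq> 0"
proof -
  have "pderiv (legendre k) \<noteq> 0"
    using assms by (simp add: pderiv_eq_0_iff degree_legendre)
  then show "degree (lobatto_poly k) = Suc k" "lobatto_poly k \<noteq> 0"
    using assms by (simp_all add: degree_mult_eq degree_pderiv degree_legendre del: mult_pCons_left)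
qed

text \<open>Rolle turns the k zeros of the Legendre polynomial into k - 1 zeros of its derivative;
  with the two end points these are as many as the degree k + 1 allows. Only then does
  \<open>gl_node\<close>, an index into the sorted root list, have the intended meaning.\<close>

lemma lobatto_roots:
  assumes k: "k \<ge> 1"
  defines "Z \<equiv> {x. poly (lobatto_poly k) x = 0}"
  shows "finite Z" "card Z = Suc k" "{-1, 1} \<subseteq> Z" "Z \<subseteq> {-1..1}"
proof -
  obtain R where R: "finite R" "card R = k" "R \<subseteq> {-1<..<1}" "\<And>z. z \<in> R \<Longrightarrow> poly (legendre k) z = 0"
    using rodrigues_roots[of k k] by (auto simp: legendre_rodrigues)
  have "R \<noteq> {}" using R k by auto
  then obtain Q where Q: "finite Q" "card R = Suc (card Q)"
      "\<And>z. z\<in>Q \<Longrightarrow> poly (pderiv (legendre k)) z = 0 \<and> Min R < z \<and> z < Max R"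
    using rolle_roots[of R "legendre k"] R(1,4) by blast
  have "Min R \<in> R" "Max R \<in> R" using R \<open>R \<noteq> {}\<close> by auto
  then have Q1: "Q \<subseteq> {-1<..<1}" using Q(3) R(3) by fastforce
  define S where "S = insert 1 (insert (-1) Q)"
  have cS: "card S = Suc k" using Q1 Q R by (auto simp: S_def card_insert_if)
  have SZ: "S \<subseteq> Z" using Q(3) by (auto simp: S_def Z_def)
  show fZ: "finite Z" unfolding Z_def using degree_lobatto_poly[OF k] by (intro poly_roots_finite) auto
  have "card Z \<le> Suc k"
    unfolding Z_def using card_poly_roots_bound[of "lobatto_poly k"] degree_lobatto_poly[OF k] by simp
  then have "S = Z" using card_seteq[OF fZ SZ] cS by simp
  then show "card Z = Suc k" "{-1, 1} \<subseteq> Z" "Z \<subseteq> {-1..1}"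
    using cS Q1 by (auto simp: S_def)
qed

lemma
  assumes k: "k \<ge> 1"
  shows gl_node_less: "\<And>r s. r < s \<Longrightarrow> s \<le> k \<Longrightarrow> gl_node k r < gl_node k s"
    and gl_node_root: "\<And>r. r \<le> k \<Longrightarrow> poly (lobatto_poly k) (gl_node k r) = 0"
    and gl_node_range: "\<And>r. r \<le> k \<Longrightarrow> gl_node k r \<in> {-1..1}"
    and gl_node_0: "gl_node k 0 = -1"
    and gl_node_last: "gl_node k k = 1"
proof -
  define Z where "Z = {x. poly (lobatto_poly k) x = 0}"
  define xs where "xs = sorted_list_of_set Z"
  note Z = lobatto_roots[OF k, folded Z_def]
  have len: "length xs = Suc k" using Z by (simp add: xs_def)
  have set: "set xs = Z" using Z by (simp add: xs_def)
  have nd: "gl_node k r = xs ! r" for r by (simp add: gl_node_def xs_def Z_def)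
  have "sorted_wrt (<) xs" by (simp add: xs_def strict_sorted_iff)
  then show less: "gl_node k r < gl_node k s" if "r < s" "s \<le> k" for r s
    using that len by (simp add: nd sorted_wrt_iff_nth_less)
  have inZ: "gl_node k r \<in> Z" if "r \<le> k" for r
    using that len set nth_mem[of r xs] by (simp add: nd)
  then show "poly (lobatto_poly k) (gl_node k r) = 0" if "r \<le> k" for r
    using that by (simp add: Z_def)
  show range: "gl_node k r \<in> {-1..1}" if "r \<le> k" for r
    using inZ[OF that] Z by auto
  have ex: "\<exists>r\<le>k. gl_node k r = z" if "z \<in> Z" for z
    using that set len by (auto simp: nd in_set_conv_nth less_Suc_eq_le)
  \<comment> \<open>A positive index for the node -1 would leave node 0 below -1, out of range; the
    other end is symmetric.\<close>
  obtain r where r: "r \<le> k" "gl_node k r = -1" using ex[of "-1"] Z by auto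
  show "gl_node k 0 = -1" using less[of 0 r] r range[of 0] by (cases "r = 0") auto
  obtain r where r: "r \<le> k" "gl_node k r = 1" using ex[of 1] Z by auto
  show "gl_node k k = 1" using less[of r k] r range[of k] by (cases "r = k") auto
qed

lemma gl_node_eq_iff: "k \<ge> 1 \<Longrightarrow> r \<le> k \<Longrightarrow> s \<le> k \<Longrightarrow> gl_node k r = gl_node k s \<longleftrightarrow> r = s"
  using gl_node_less by (metis less_irrefl linorder_neqE_nat)

section \<open>Lagrange interpolation at the nodes\<close>

definition lagrange_poly :: "nat \<Rightarrow> nat \<Rightarrow> real poly" where
  "lagrange_poly k r =
     (\<Prod>s\<in>{..k} - {r}. smult (1 / (gl_node k r - gl_node k s)) [:- gl_node k s, 1:])"

lemma poly_lagrange_poly: "poly (lagrange_poly k r) x = lagrange_basis k r x"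
  by (simp add: lagrange_poly_def lagrange_basis_def poly_prod diff_divide_distrib)

lemma degree_lagrange_poly: "r \<le> k \<Longrightarrow> degree (lagrange_poly k r) \<le> k"
proof -
  assume r: "r \<le> k"
  have "degree (lagrange_poly k r) \<le> sum (\<lambda>s. 1) ({..k} - {r})"
    unfolding lagrange_poly_def
    by (rule order_trans[OF degree_prod_sum_le sum_mono]) (simp_all add: o_def degree_smult_le)
  also have "\<dots> = k" using r by simp
  finally show ?thesis .
qed

lemma lagrange_basis_node:
  assumes "k \<ge> 1" "r \<le> k" "s \<le> k"
  shows "lagrange_basis k r (gl_node k s) = (if r = s then 1 else 0)"
  using assms by (auto simp: lagrange_basis_def gl_node_eq_iff)

lemma lagrange_interpolation:
  assumes k: "k \<ge> 1" and "degree p \<le> k"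
  shows "p = (\<Sum>r\<le>k. smult (poly p (gl_node k r)) (lagrange_poly k r))"
proof (rule poly_eqI_degree[where A = "gl_node k ` {..k}"])
  show "poly p x = poly (\<Sum>r\<le>k. smult (poly p (gl_node k r)) (lagrange_poly k r)) x"
    if "x \<in> gl_node k ` {..k}" for x
    using that k by (auto simp: poly_sum poly_lagrange_poly lagrange_basis_node if_distrib cong: if_cong)
  have c: "card (gl_node k ` {..k}) = Suc k"
    using k by (subst card_image) (auto simp: inj_on_def gl_node_eq_iff)
  show "degree p < card (gl_node k ` {..k})" using assms c by simp
  have "degree (\<Sum>r\<le>k. smult (poly p (gl_node k r)) (lagrange_poly k r)) \<le> k"
    by (intro degree_sum_le) (auto simp: degree_lagrange_poly)
  then show "degree (\<Sum>r\<le>k. smult (poly p (gl_node k r)) (lagrange_poly k r)) < card (gl_node k ` {..k})"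
    using c by simp
qed

section \<open>Exactness of the rule and sign of its weights\<close>

lemma poly_integrable: "poly p integrable_on {a..b::real}"
  by (intro integrable_continuous_real continuous_intros)

lemma integral_poly_add: "integral {a..b::real} (poly (p + q)) = integral {a..b} (poly p) + integral {a..b} (poly q)"
  using integral_add[OF poly_integrable poly_integrable, of a b p q] by (simp add: poly_add[abs_def])

lemma integral_poly_sum_smult:
  "integral {a..b::real} (poly (\<Sum>i\<in>A. smult (c i) (p i))) = (\<Sum>i\<in>A. c i * integral {a..b} (poly (p i)))"
proof (induction A rule: infinite_finite_induct)
  case (insert i A)
  have "integral {a..b} (poly (smult (c i) (p i))) = c i * integral {a..b} (poly (p i))"
    by (simp add: poly_smult[abs_def])
  with insert show ?case by (simp add: integral_poly_add del: poly_add)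
qed (simp_all add: poly_0[abs_def])

lemma integral_poly_pderiv:
  assumes "a \<le> b"
  shows "integral {a..b::real} (poly (pderiv p)) = poly p b - poly p a"
  using assms by (intro integral_unique fundamental_theorem_of_calculus)
    (auto simp flip: has_real_derivative_iff_has_vector_derivative intro: poly_DERIV DERIV_subset)

text \<open>Integration by parts n times: each step moves one derivative onto \<open>r\<close>, and
  the boundary term carries a lower derivative of (x^2 - 1)^k, which vanishes at both ends. The case
  n = k is the orthogonality of the Legendre polynomial to lower degrees.\<close>

lemma integral_rodrigues:
  assumes "n \<le> k" "r = 0 \<or> degree r < n"
  shows "integral {-1..1} (poly (rodrigues k n * r)) = 0"
  using assms
proof (induction n arbitrary: r)
  case 0
  then show ?case by simp
next
  case (Suc n)
  \<comment> \<open>A constant \<open>r\<close> has derivative 0; the alternative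
    \<open>r = 0\<close> in the hypothesis exists for this case, since no degree is below 0.\<close>
  have "pderiv r = 0 \<or> degree (pderiv r) < n"
    using Suc.prems by (cases "n = 0") (auto simp: pderiv_eq_0_iff degree_pderiv)
  then have 1: "integral {-1..1} (poly (rodrigues k n * pderiv r)) = 0"
    using Suc.prems by (intro Suc.IH) auto
  have "integral {-1..1} (poly (pderiv (rodrigues k n * r))) = 0"
    using Suc.prems by (subst integral_poly_pderiv) (simp_all add: rodrigues_endpoints)
  with 1 show ?case
    by (simp only: pderiv_mult integral_poly_add rodrigues_Suc mult.commute[of r])
qed

text \<open>Integration by parts moves the derivative from \<open>P\<^sub>k\<close> to \<open>(1 - x\<^sup>2) q\<close>, which leaves a
  polynomial of degree below \<open>k\<close>, orthogonal to \<open>P\<^sub>k\<close>.\<close>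
lemma integral_lobatto_poly:
  assumes k: "k \<ge> 1" and q: "q = 0 \<or> degree q + 2 \<le> k"
  shows "integral {-1..1} (poly (lobatto_poly k * q)) = 0"
proof (cases "q = 0")
  case False
  define g where "g = [:1, 0, -1:] * q"
  have "degree g = degree q + 2"
    using False by (simp add: g_def degree_mult_eq del: mult_pCons_left)
  then have d: "degree (pderiv g) < k" using False q k by (simp add: degree_pderiv)
  define c where "c = 1 / (2 ^ k * fact k :: real)"
  have "legendre k * pderiv g = rodrigues k k * smult c (pderiv g)"
    by (simp add: legendre_rodrigues c_def)
  moreover have "degree (smult c (pderiv g)) < k" using d by (meson degree_smult_le order_le_less_trans)
  ultimately have "integral {-1..1} (poly (legendre k * pderiv g)) = 0"
    using integral_rodrigues[of k k "smult c (pderiv g)"] by (simp only:) blast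
  moreover have "integral {-1..1} (poly (pderiv (legendre k * g))) = 0"
    by (subst integral_poly_pderiv) (simp_all add: g_def)
  ultimately have "integral {-1..1} (poly (g * pderiv (legendre k))) = 0"
    by (simp add: pderiv_mult integral_poly_add)
  then show ?thesis by (simp only: g_def mult_ac)
qed (simp add: poly_0[abs_def])

text \<open>Division by the nodal polynomial \<open>w\<close>: the remainder has degree at most k
  and is integrated exactly through interpolation, while \<open>w * q\<close> vanishes at all nodes
  and has integral 0 by orthogonality.\<close>

lemma gl_quadrature_exact:
  assumes k: "k \<ge> 1" and p: "degree p < 2 * k"
  shows "(\<Sum>r\<le>k. gl_weight k r * poly p (gl_node k r)) = integral {-1..1} (poly p)"
proof -
  define w where "w = lobatto_poly k"
  define q where "q = p div w"
  define m where "m = p mod w"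
  note w = degree_lobatto_poly[OF k, folded w_def]
  have pe: "p = m + w * q" by (simp add: q_def m_def)
  have m: "degree m \<le> k"
    using degree_mod_less'[of w p] w by (cases "m = 0") (auto simp: m_def)
  \<comment> \<open>\<open>w * q\<close> has degree below 2k and \<open>w\<close> has degree k + 1,
    which leaves at most k - 2 for a nonzero \<open>q\<close>.\<close>
  have q: "q = 0 \<or> degree q + 2 \<le> k"
  proof (cases "q = 0")
    case False
    then have "degree (w * q) = Suc k + degree q" using w by (simp add: degree_mult_eq)
    moreover have "w * q = p - m" by (simp add: pe)
    moreover have "degree (p - m) < 2 * k" using p m k by (intro degree_diff_less) auto
    ultimately show ?thesis by simp
  qed simp
  have node: "poly p (gl_node k r) = poly m (gl_node k r)" if "r \<le> k" for r
    using gl_node_root[OF k that] by (subst pe) (simp add: w_def del: mult_pCons_left)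
  have "integral {-1..1} (poly p) = integral {-1..1} (poly m)"
    using integral_lobatto_poly[OF k q] by (subst pe) (simp add: integral_poly_add w_def del: mult_pCons_left)
  also have "\<dots> = (\<Sum>r\<le>k. poly m (gl_node k r) * integral {-1..1} (poly (lagrange_poly k r)))"
    by (subst lagrange_interpolation[OF k m]) (rule integral_poly_sum_smult)
  also have "\<dots> = (\<Sum>r\<le>k. gl_weight k r * poly p (gl_node k r))"
    by (intro sum.cong) (auto simp: gl_weight_def node poly_lagrange_poly[abs_def])
  finally show ?thesis by simp
qed

text \<open>Integrate a polynomial that is nonnegative on \<open>[-1, 1]\<close> and vanishes at all nodes but the
  \<open>r\<close>-th: simple factors at the end points and double factors at the interior nodes keep its degree
  below \<open>2 k\<close>.\<close>
lemma gl_weight_nonneg: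
  assumes k: "k \<ge> 1" and r: "r \<le> k"
  shows "gl_weight k r \<ge> 0"
proof -
  define f where "f s = (if s = 0 then [:1, 1:] else if s = k then [:1, -1:]
     else [:- gl_node k s, 1:] ^ 2)" for s
  define p where "p = (\<Prod>s\<in>{..k} - {r}. f s)"
  define d where "d s = (if s = 0 \<or> s = k then 1 else 2 :: nat)" for s
  have "degree p \<le> sum d ({..k} - {r})"
    unfolding p_def
    by (rule order_trans[OF degree_prod_sum_le sum_mono])
      (auto simp: f_def d_def degree_power_eq)
  also have "\<dots> < 2 * k"
  proof -
    have "{..k} = insert 0 (insert k {0<..<k})" using k by auto
    then have "sum d {..k} = d 0 + (d k + sum d {0<..<k})" using k by simp
    also have "sum d {0<..<k} = sum (\<lambda>s. 2) {0<..<k}" by (intro sum.cong) (auto simp: d_def)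
    finally have "sum d {..k} = 2 * k" using k by (auto simp: d_def)
    moreover have "sum d {..k} = d r + sum d ({..k} - {r})" using r by (intro sum.remove) auto
    moreover have "d r \<ge> 1" by (simp add: d_def)
    ultimately show ?thesis by linarith
  qed
  finally have dp: "degree p < 2 * k" .
  have f0: "poly (f s) x \<ge> 0" if "x \<in> {-1..1}" for s x
    using that by (auto simp: f_def)
  have fpos: "poly (f s) (gl_node k r) > 0" if "s \<le> k" "s \<noteq> r" for s
  proof -
    have ne: "gl_node k r \<noteq> gl_node k s" using that r k by (simp add: gl_node_eq_iff)
    have "gl_node k r \<in> {-1..1}" using gl_node_range k r by blast
    then show ?thesis
      using ne gl_node_0[OF k] gl_node_last[OF k] by (auto simp: f_def)
  qed
  have fz: "poly (f s) (gl_node k s) = 0" for s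
    using gl_node_0[OF k] gl_node_last[OF k] by (auto simp: f_def)
  have "integral {-1..1} (poly p) \<ge> 0"
    by (intro integral_nonneg poly_integrable) (auto simp: p_def poly_prod intro!: prod_nonneg f0)
  also have "integral {-1..1} (poly p) = (\<Sum>s\<le>k. gl_weight k s * poly p (gl_node k s))"
    using gl_quadrature_exact[OF k dp] by simp
  also have "\<dots> = (\<Sum>s\<in>{r}. gl_weight k s * poly p (gl_node k s))"
    using r fz by (intro sum.mono_neutral_right) (auto simp: p_def poly_prod)
  finally have "0 \<le> gl_weight k r * poly p (gl_node k r)" by simp
  moreover have "poly p (gl_node k r) > 0"
    unfolding p_def poly_prod using fpos by (intro prod_pos) auto
  ultimately show ?thesis by (simp add: zero_le_mult_iff)
qed

section \<open>Summation by parts on the reference interval\<close>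

definition diff_matrix :: "nat \<Rightarrow> nat \<Rightarrow> nat \<Rightarrow> real" where
  "diff_matrix k r s = poly (pderiv (lagrange_poly k s)) (gl_node k r)"

text \<open>The product of two basis polynomials has a derivative of degree below 2k, so its
  quadrature is exactly the difference of the end values. In matrix form, W D plus its transpose is
  diag(-1, 0, ..., 0, 1).\<close>

lemma diff_matrix_sbp:
  assumes k: "k \<ge> 1" and r: "r \<le> k" and s: "s \<le> k"
  shows "gl_weight k r * diff_matrix k r s + gl_weight k s * diff_matrix k s r =
    (if r = k \<and> s = k then 1 else 0) - (if r = 0 \<and> s = 0 then 1 else 0)"
proof -
  let ?L = "lagrange_poly k"
  have "degree (?L r * ?L s) \<le> k + k"
    using degree_lagrange_poly r s by (intro order_trans[OF degree_mult_le] add_mono) auto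
  then have "degree (pderiv (?L r * ?L s)) < 2 * k" using k by (simp add: degree_pderiv)
  from gl_quadrature_exact[OF k this]
  have "(\<Sum>q\<le>k. gl_weight k q * poly (pderiv (?L r * ?L s)) (gl_node k q)) =
      poly (?L r * ?L s) 1 - poly (?L r * ?L s) (-1)"
    by (simp add: integral_poly_pderiv)
  also have "poly (?L r * ?L s) 1 = (if r = k \<and> s = k then 1 else 0)"
    using lagrange_basis_node[OF k, of _ k] r s
    by (simp add: gl_node_last[OF k] poly_lagrange_poly)
  also have "poly (?L r * ?L s) (-1) = (if r = 0 \<and> s = 0 then 1 else 0)"
    using lagrange_basis_node[OF k, of _ 0] r s
    by (simp add: gl_node_0[OF k] poly_lagrange_poly)
  \<comment> \<open>After the product rule each summand contains an undifferentiated basis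
    polynomial, so only q = r and q = s contribute.\<close>
  also have "(\<Sum>q\<le>k. gl_weight k q * poly (pderiv (?L r * ?L s)) (gl_node k q)) =
     (\<Sum>q\<le>k. (if r = q then gl_weight k q * diff_matrix k q s else 0) +
              (if s = q then gl_weight k q * diff_matrix k q r else 0))"
    using r s k by (intro sum.cong)
      (auto simp: pderiv_mult poly_lagrange_poly lagrange_basis_node diff_matrix_def algebra_simps)
  also have "\<dots> = gl_weight k r * diff_matrix k r s + gl_weight k s * diff_matrix k s r"
    using r s by (simp add: sum.distrib)
  finally show ?thesis .
qed

section \<open>Interpolation on cells\<close>

lemma is_mesh_cell_width: "is_mesh X \<Longrightarrow> i \<in> {1..ncells X} \<Longrightarrow> cell_width X i > 0"
  unfolding is_mesh_def cell_width_def lpt_def rpt_def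
  by (metis Suc_diff_1 atLeastAtMost_iff diff_gt_0_iff_gt lessI less_le_trans Suc_le_lessD One_nat_def)

lemma cell_node_0: "k \<ge> 1 \<Longrightarrow> cell_node k X i 0 = lpt X i"
  by (simp add: cell_node_def gl_node_0 cell_width_def field_simps)

lemma cell_node_last: "k \<ge> 1 \<Longrightarrow> cell_node k X i k = rpt X i"
  by (simp add: cell_node_def gl_node_last cell_width_def field_simps)

lemma cell_node_in_cell:
  assumes "k \<ge> 1" "r \<le> k" "cell_width X i > 0"
  shows "cell_node k X i r \<in> {lpt X i..rpt X i}"
proof -
  have "gl_node k r \<in> {-1..1}" using assms gl_node_range by blast
  then have "\<bar>cell_width X i / 2 * gl_node k r\<bar> \<le> cell_width X i / 2 * 1"
    using assms(3) unfolding abs_mult by (intro mult_mono) auto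
  then have "\<bar>cell_node k X i r - (lpt X i + rpt X i) / 2\<bar> \<le> cell_width X i / 2"
    by (simp add: cell_node_def)
  then show ?thesis by (simp add: cell_width_def abs_le_iff) argo
qed

lemma reference_coordinate_node:
  "cell_width X i \<noteq> 0 \<Longrightarrow>
    (2 * cell_node k X i r - lpt X i - rpt X i) / cell_width X i = gl_node k r"
  by (simp add: cell_node_def field_simps)

lemma cell_basis_node:
  assumes "k \<ge> 1" "cell_width X i \<noteq> 0" "r \<le> k" "s \<le> k"
  shows "cell_basis k X i r (cell_node k X i s) = (if r = s then 1 else 0)"
  using assms by (simp add: cell_basis_def reference_coordinate_node lagrange_basis_node)

lemma cell_basis_coeffs:
  assumes "r \<le> k"
  shows "\<exists>c. \<forall>x. cell_basis k X i r x = (\<Sum>a\<le>k. c a * x ^ a)"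
proof -
  define p where "p = lagrange_poly k r \<circ>\<^sub>p [:- (lpt X i + rpt X i) / cell_width X i, 2 / cell_width X i:]"
  have "degree p \<le> degree (lagrange_poly k r) * 1"
    unfolding p_def by (rule order_trans[OF degree_pcompose_le]) (intro mult_left_mono, auto)
  then have d: "degree p \<le> k" using degree_lagrange_poly[OF assms] by simp
  have "cell_basis k X i r x = poly p x" for x
    by (simp add: p_def cell_basis_def poly_pcompose poly_lagrange_poly diff_divide_distrib add_divide_distrib mult.commute)
      (simp add: algebra_simps)
  moreover have "poly p x = (\<Sum>a\<le>k. coeff p a * x ^ a)" for x
    unfolding poly_altdef using d
    by (intro sum.mono_neutral_left) (auto simp: not_le intro!: coeff_eq_0)
  ultimately show ?thesis by auto
qed

text \<open>As \<open>v\<close> is an arbitrary piecewise function, interpolants of the nonlinear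
  quantities become admissible test functions.\<close>

lemma gl_interp_dg_space: "gl_interp k X Y v \<in> dg_space k X Y"
  unfolding dg_space_def
proof (clarify)
  fix i j l
  have "\<forall>r\<in>{..k}. \<exists>c. \<forall>x. cell_basis k X i r x = (\<Sum>a\<le>k. c a * x ^ a)"
    using cell_basis_coeffs by blast
  then obtain c where c: "\<And>r x. r \<le> k \<Longrightarrow> cell_basis k X i r x = (\<Sum>a\<le>k. c r a * x ^ a)"
    by (auto dest!: bchoice)
  have "\<forall>s\<in>{..k}. \<exists>d. \<forall>y. cell_basis k Y j s y = (\<Sum>b\<le>k. d b * y ^ b)"
    using cell_basis_coeffs by blast
  then obtain d where d: "\<And>s y. s \<le> k \<Longrightarrow> cell_basis k Y j s y = (\<Sum>b\<le>k. d s b * y ^ b)"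
    by (auto dest!: bchoice)
  define V where "V r s = v i j (cell_node k X i r) (cell_node k Y j s) $ l" for r s
  have "gl_interp k X Y v i j x y $ l =
      (\<Sum>a\<le>k. \<Sum>b\<le>k. (\<Sum>r\<le>k. \<Sum>s\<le>k. c r a * d s b * V r s) * x ^ a * y ^ b)" for x y
  proof -
    have "gl_interp k X Y v i j x y $ l =
        (\<Sum>r\<le>k. \<Sum>s\<le>k. (\<Sum>a\<le>k. c r a * x ^ a) * (\<Sum>b\<le>k. d s b * y ^ b) * V r s)"
      by (simp add: gl_interp_def c d V_def)
    also have "\<dots> = (\<Sum>r\<le>k. \<Sum>s\<le>k. \<Sum>a\<le>k. \<Sum>b\<le>k. c r a * d s b * V r s * x ^ a * y ^ b)"
      by (intro sum.cong refl) (simp only: sum_product, simp only: sum_distrib_right, simp only: mult_ac)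
    also have "\<dots> = (\<Sum>r\<le>k. \<Sum>a\<le>k. \<Sum>s\<le>k. \<Sum>b\<le>k. c r a * d s b * V r s * x ^ a * y ^ b)"
      by (intro sum.cong refl sum.swap)
    also have "\<dots> = (\<Sum>a\<le>k. \<Sum>r\<le>k. \<Sum>b\<le>k. \<Sum>s\<le>k. c r a * d s b * V r s * x ^ a * y ^ b)"
      by (subst sum.swap) (intro sum.cong refl sum.swap)
    also have "\<dots> = (\<Sum>a\<le>k. \<Sum>b\<le>k. \<Sum>r\<le>k. \<Sum>s\<le>k. c r a * d s b * V r s * x ^ a * y ^ b)"
      by (intro sum.cong refl sum.swap)
    finally show ?thesis by (simp add: sum_distrib_right)
  qed
  then show "\<exists>c. \<forall>x\<in>{lpt X i..rpt X i}. \<forall>y\<in>{lpt Y j..rpt Y j}.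
      gl_interp k X Y v i j x y $ l = (\<Sum>a\<le>k. \<Sum>b\<le>k. c a b * x ^ a * y ^ b)"
    by (intro exI[of _ "\<lambda>a b. \<Sum>r\<le>k. \<Sum>s\<le>k. c r a * d s b * V r s"]) simp
qed

lemma gl_interp_node:
  assumes "k \<ge> 1" "cell_width X i \<noteq> 0" "cell_width Y j \<noteq> 0" "r \<le> k" "s \<le> k"
  shows "gl_interp k X Y v i j (cell_node k X i r) (cell_node k Y j s) =
    v i j (cell_node k X i r) (cell_node k Y j s)"
proof -
  have "gl_interp k X Y v i j (cell_node k X i r) (cell_node k Y j s) =
    (\<Sum>r'\<le>k. \<Sum>s'\<le>k. if s' = s then (if r' = r then v i j (cell_node k X i r) (cell_node k Y j s) else 0) else 0)"
    unfolding gl_interp_def using assms by (intro sum.cong refl) (auto simp: cell_basis_node)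
  then show ?thesis using assms by simp
qed

lemma gl_interp_idem:
  assumes "k \<ge> 1" "cell_width X i \<noteq> 0" "cell_width Y j \<noteq> 0"
  shows "gl_interp k X Y (gl_interp k X Y v) i j x y = gl_interp k X Y v i j x y"
  unfolding gl_interp_def[of k X Y "gl_interp k X Y v"]
  by (simp add: gl_interp_node[OF assms]) (simp add: gl_interp_def)

lemma gl_interp_swap:
  "gl_interp k X Y v i j x y = gl_interp k Y X (\<lambda>j i y x. v i j x y) j i y x"
  unfolding gl_interp_def by (subst sum.swap) (simp add: mult.commute)

text \<open>Exchanging the axes lets summation by parts in y be read off the one in x.\<close>

lemma qdy_eq_qdx: "qdy k X Y v i j x y = qdx k Y X (\<lambda>j i y x. v i j x y) j i y x"
  unfolding qdx_def qdy_def by (subst gl_interp_swap) simp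

lemma qdx_gl_interp:
  assumes "k \<ge> 1" "cell_width X i \<noteq> 0" "cell_width Y j \<noteq> 0"
  shows "qdx k X Y (gl_interp k X Y v) i j x y = qdx k X Y v i j x y"
    and "qdy k X Y (gl_interp k X Y v) i j x y = qdy k X Y v i j x y"
  by (simp_all only: qdx_def qdy_def gl_interp_idem[OF assms])

lemma cell_basis_deriv_node:
  assumes "cell_width X i \<noteq> 0"
  shows "(cell_basis k X i s has_real_derivative 2 / cell_width X i * diff_matrix k r s)
    (at (cell_node k X i r))"
proof -
  have "((\<lambda>x. (2 * x - lpt X i - rpt X i) / cell_width X i) has_real_derivative 2 / cell_width X i)
      (at (cell_node k X i r))"
    using assms by (auto intro!: derivative_eq_intros)
  from DERIV_chain'[OF this poly_DERIV[of "lagrange_poly k s"]] show ?thesis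
    using assms by (simp add: reference_coordinate_node poly_lagrange_poly diff_matrix_def
        cell_basis_def[abs_def] mult.commute)
qed

text \<open>On a grid line through nodes all basis functions in y but one vanish, so the tensor
  derivative is the one-dimensional matrix acting along that line, scaled by the slope of the map to
  the reference interval.\<close>

lemma qdx_node:
  assumes "k \<ge> 1" "cell_width X i \<noteq> 0" "cell_width Y j \<noteq> 0" "s \<le> k"
  shows "qdx k X Y v i j (cell_node k X i r) (cell_node k Y j s) =
    (\<Sum>r'\<le>k. (2 / cell_width X i * diff_matrix k r r') *\<^sub>R
       v i j (cell_node k X i r') (cell_node k Y j s))"
proof -
  have "gl_interp k X Y v i j x (cell_node k Y j s) =
      (\<Sum>r'\<le>k. cell_basis k X i r' x *\<^sub>R v i j (cell_node k X i r') (cell_node k Y j s))" for x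
  proof -
    have "gl_interp k X Y v i j x (cell_node k Y j s) = (\<Sum>r'\<le>k. \<Sum>s'\<le>k. if s' = s then
        cell_basis k X i r' x *\<^sub>R v i j (cell_node k X i r') (cell_node k Y j s) else 0)"
      unfolding gl_interp_def using assms by (intro sum.cong refl) (auto simp: cell_basis_node)
    then show ?thesis using assms by simp
  qed
  moreover have "((\<lambda>x. \<Sum>r'\<le>k. cell_basis k X i r' x *\<^sub>R v i j (cell_node k X i r') (cell_node k Y j s))
      has_vector_derivative (\<Sum>r'\<le>k. (2 / cell_width X i * diff_matrix k r r') *\<^sub>R
       v i j (cell_node k X i r') (cell_node k Y j s))) (at (cell_node k X i r))"
    using cell_basis_deriv_node[OF assms(2)]
    by (auto intro!: has_vector_derivative_sum derivative_eq_intros)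
  ultimately show ?thesis by (simp add: qdx_def vector_derivative_at)
qed

section \<open>Summation by parts on cells\<close>

lemma cell_quad_cong:
  "(\<And>r. r \<le> k \<Longrightarrow> f (cell_node k X i r) = g (cell_node k X i r)) \<Longrightarrow>
    cell_quad k X i f = cell_quad k X i g"
  by (simp add: cell_quad_def)

lemma cell_quad_add: "cell_quad k X i (\<lambda>x. f x + g x) = cell_quad k X i f + cell_quad k X i g"
  by (simp add: cell_quad_def sum.distrib algebra_simps)

lemma cell_quad_diff: "cell_quad k X i (\<lambda>x. f x - g x) = cell_quad k X i f - cell_quad k X i g"
  by (simp add: cell_quad_def sum_subtractf algebra_simps)

lemma cell_quad_cmult: "cell_quad k X i (\<lambda>x. c * f x) = c * cell_quad k X i f"
  by (simp add: cell_quad_def sum_distrib_left algebra_simps)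

lemma cell_quad_sum: "cell_quad k X i (\<lambda>x. \<Sum>a\<in>A. f a x) = (\<Sum>a\<in>A. cell_quad k X i (f a))"
  unfolding cell_quad_def sum_distrib_left by (rule sum.swap)

lemma cell_quad_swap:
  "cell_quad k X i (\<lambda>x. cell_quad k Y j (\<lambda>y. f x y)) = cell_quad k Y j (\<lambda>y. cell_quad k X i (\<lambda>x. f x y))"
  unfolding cell_quad_def sum_distrib_left by (subst sum.swap) (simp add: mult_ac)

lemma cell_quad_nonneg:
  assumes "k \<ge> 1" "cell_width X i > 0" "\<And>x. x \<in> {lpt X i..rpt X i} \<Longrightarrow> f x \<ge> 0"
  shows "cell_quad k X i f \<ge> 0"
  unfolding cell_quad_def using assms
  by (intro mult_nonneg_nonneg sum_nonneg gl_weight_nonneg assms(3) cell_node_in_cell) auto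

lemma cell_quad2_cong:
  "(\<And>r s. r \<le> k \<Longrightarrow> s \<le> k \<Longrightarrow>
      f (cell_node k X i r) (cell_node k Y j s) = g (cell_node k X i r) (cell_node k Y j s)) \<Longrightarrow>
    cell_quad2 k X Y i j f = cell_quad2 k X Y i j g"
  unfolding cell_quad2_def by (intro cell_quad_cong) auto

lemma cell_quad2_add:
  "cell_quad2 k X Y i j (\<lambda>x y. f x y + g x y) = cell_quad2 k X Y i j f + cell_quad2 k X Y i j g"
  by (simp add: cell_quad2_def cell_quad_add)

lemma mesh_quad2_cells:
  "mesh_quad2 k X Y f = (\<Sum>i=1..ncells X. \<Sum>j=1..ncells Y. cell_quad2 k X Y i j (f i j))"
  unfolding mesh_quad2_def mesh_quad_def cell_quad2_def cell_quad_sum by (rule sum.swap)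

text \<open>Renaming indices in the second double sum gives \<open>a r \<bullet> b s\<close> the
  symmetrized coefficient, which \<open>diff_matrix_sbp\<close> makes zero except in the two
  corners.\<close>

lemma sbp_nodes:
  fixes a b :: "nat \<Rightarrow> 'a::real_inner"
  assumes k: "k \<ge> 1"
  shows "(\<Sum>r\<le>k. gl_weight k r * (a r \<bullet> (\<Sum>s\<le>k. diff_matrix k r s *\<^sub>R b s)
      + b r \<bullet> (\<Sum>s\<le>k. diff_matrix k r s *\<^sub>R a s))) = a k \<bullet> b k - a 0 \<bullet> b 0"
proof -
  let ?c = "\<lambda>r s. gl_weight k r * diff_matrix k r s"
  have "(\<Sum>r\<le>k. gl_weight k r * (a r \<bullet> (\<Sum>s\<le>k. diff_matrix k r s *\<^sub>R b s)
      + b r \<bullet> (\<Sum>s\<le>k. diff_matrix k r s *\<^sub>R a s)))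
      = (\<Sum>r\<le>k. \<Sum>s\<le>k. ?c r s * (a r \<bullet> b s)) + (\<Sum>r\<le>k. \<Sum>s\<le>k. ?c r s * (b r \<bullet> a s))"
    by (simp add: inner_sum_right sum_distrib_left distrib_left sum.distrib mult.assoc)
  also have "(\<Sum>r\<le>k. \<Sum>s\<le>k. ?c r s * (b r \<bullet> a s)) = (\<Sum>r\<le>k. \<Sum>s\<le>k. ?c s r * (a r \<bullet> b s))"
    by (subst sum.swap) (simp add: inner_commute)
  also have "(\<Sum>r\<le>k. \<Sum>s\<le>k. ?c r s * (a r \<bullet> b s)) + \<dots>
      = (\<Sum>r\<le>k. \<Sum>s\<le>k. (?c r s + ?c s r) * (a r \<bullet> b s))"
    by (simp add: sum.distrib distrib_right)
  also have "\<dots> = (\<Sum>r\<le>k. \<Sum>s\<le>k. (if s = k then if r = k then a k \<bullet> b k else 0 else 0)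
      - (if s = 0 then if r = 0 then a 0 \<bullet> b 0 else 0 else 0))"
    by (intro sum.cong refl) (auto simp: diff_matrix_sbp[OF k])
  also have "\<dots> = a k \<bullet> b k - a 0 \<bullet> b 0"
    by (simp add: sum_subtractf)
  finally show ?thesis .
qed

text \<open>At nodes \<open>qdx\<close> depends on nodal values only, so \<open>u\<close> and
  \<open>v\<close> can be arbitrary. The factor \<open>cell_width X i / 2\<close> of the quadrature
  cancels the inverse factor of the derivative.\<close>

lemma cell_quad_sbp_x:
  assumes k: "k \<ge> 1" and w: "cell_width X i \<noteq> 0" "cell_width Y j \<noteq> 0"
    and y: "y = cell_node k Y j s" "s \<le> k"
  shows "cell_quad k X i (\<lambda>x. u i j x y \<bullet> qdx k X Y v i j x y + v i j x y \<bullet> qdx k X Y u i j x y)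
    = u i j (rpt X i) y \<bullet> v i j (rpt X i) y - u i j (lpt X i) y \<bullet> v i j (lpt X i) y"
proof -
  have q: "qdx k X Y v i j (cell_node k X i r) y = (2 / cell_width X i) *\<^sub>R
      (\<Sum>r'\<le>k. diff_matrix k r r' *\<^sub>R v i j (cell_node k X i r') y)" for v :: "'a pw_fun" and r
    using qdx_node[OF k w y(2)] by (simp add: y(1) scaleR_right.sum)
  show ?thesis
    unfolding cell_node_0[OF k, symmetric] cell_node_last[OF k, symmetric]
      sbp_nodes[OF k, of "\<lambda>r. u i j (cell_node k X i r) y" "\<lambda>r. v i j (cell_node k X i r) y", symmetric]
    unfolding cell_quad_def sum_distrib_left q
    by (intro sum.cong refl) (use w in \<open>simp add: field_simps\<close>)
qed

lemma cell_quad_sbp_y: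
  assumes k: "k \<ge> 1" and w: "cell_width X i \<noteq> 0" "cell_width Y j \<noteq> 0"
    and x: "x = cell_node k X i r" "r \<le> k"
  shows "cell_quad k Y j (\<lambda>y. u i j x y \<bullet> qdy k X Y v i j x y + v i j x y \<bullet> qdy k X Y u i j x y)
    = u i j x (rpt Y j) \<bullet> v i j x (rpt Y j) - u i j x (lpt Y j) \<bullet> v i j x (lpt Y j)"
  unfolding qdy_eq_qdx
  using cell_quad_sbp_x[OF k w(2,1) x, of "\<lambda>j i y x. u i j x y" "\<lambda>j i y x. v i j x y"] by simp

section \<open>Entropy balance\<close>

text \<open>Here the test functions are arbitrary rather than in \<open>dg_space\<close>. The scheme
  is applied to their interpolants and no term changes: values and traces are taken at nodes, and
  \<open>qdx\<close>, \<open>qdy\<close> interpolate anyway.\<close>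

lemma dg_scheme_test:
  assumes k: "k \<ge> 1" and X: "is_mesh X" and Y: "is_mesh Y"
    and scheme: "dg_scheme k X Y F \<xi> Fux Fuy \<xi>x \<xi>y \<rho>t \<rho> ux uy"
    and i: "i \<in> {1..ncells X}" and j: "j \<in> {1..ncells Y}"
  shows "cell_quad2 k X Y i j (\<lambda>x y. \<rho>t i j x y \<bullet> \<phi> i j x y) =
      - cell_quad2 k X Y i j (\<lambda>x y.
            mat_app F \<rho> ux i j x y \<bullet> qdx k X Y \<phi> i j x y
          + mat_app F \<rho> uy i j x y \<bullet> qdy k X Y \<phi> i j x y)
      + cell_quad k Y j (\<lambda>y.
            Fux i j y \<bullet> \<phi> i j (rpt X i) y - Fux (i - 1) j y \<bullet> \<phi> i j (lpt X i) y)
      + cell_quad k X i (\<lambda>x.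
            Fuy i j x \<bullet> \<phi> i j x (rpt Y j) - Fuy i (j - 1) x \<bullet> \<phi> i j x (lpt Y j))"
    (is ?density)
    and "cell_quad2 k X Y i j (\<lambda>x y. ux i j x y \<bullet> \<psi>x i j x y + uy i j x y \<bullet> \<psi>y i j x y) =
      - cell_quad2 k X Y i j (\<lambda>x y.
            at_states \<xi> \<rho> i j x y \<bullet> (qdx k X Y \<psi>x i j x y + qdy k X Y \<psi>y i j x y))
      + cell_quad k Y j (\<lambda>y.
            \<xi>x i j y \<bullet> \<psi>x i j (rpt X i) y - \<xi>x (i - 1) j y \<bullet> \<psi>x i j (lpt X i) y)
      + cell_quad k X i (\<lambda>x.
            \<xi>y i j x \<bullet> \<psi>y i j x (rpt Y j) - \<xi>y i (j - 1) x \<bullet> \<psi>y i j x (lpt Y j))"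
    (is ?gradient)
proof -
  let ?I = "gl_interp k X Y"
  have w: "cell_width X i \<noteq> 0" "cell_width Y j \<noteq> 0"
    using is_mesh_cell_width[OF X i] is_mesh_cell_width[OF Y j] by auto
  note I = gl_interp_node[OF k w]
  have Ix: "?I v i j (rpt X i) (cell_node k Y j s) = v i j (rpt X i) (cell_node k Y j s)"
    "?I v i j (lpt X i) (cell_node k Y j s) = v i j (lpt X i) (cell_node k Y j s)" if "s \<le> k" for v :: "'a pw_fun" and s
    using I[of k s v] I[of 0 s v] that by (simp_all add: cell_node_0[OF k] cell_node_last[OF k])
  have Iy: "?I v i j (cell_node k X i r) (rpt Y j) = v i j (cell_node k X i r) (rpt Y j)"
    "?I v i j (cell_node k X i r) (lpt Y j) = v i j (cell_node k X i r) (lpt Y j)" if "r \<le> k" for v :: "'a pw_fun" and r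
    using I[of r k v] I[of r 0 v] that by (simp_all add: cell_node_0[OF k] cell_node_last[OF k])
  note cong = cell_quad2_cong cell_quad_cong arg_cong2[where f = "(+)"] arg_cong[where f = uminus]
  from scheme[unfolded dg_scheme_def, THEN conjunct1, rule_format, OF gl_interp_dg_space i j, of \<phi>]
  show ?density
    unfolding qdx_gl_interp[OF k w]
    \<comment> \<open>\<open>back_subst\<close> with the identity carries the tested equation over
      to the goal; their equality is proved term by term at the nodes.\<close>
    by (elim back_subst[of "\<lambda>x. x"]) (intro cong arg_cong2[where f = "(=)"]; simp add: I Ix Iy)
  from scheme[unfolded dg_scheme_def, THEN conjunct2, rule_format,
      OF gl_interp_dg_space gl_interp_dg_space i j, of \<psi>x \<psi>y]
  show ?gradient
    unfolding qdx_gl_interp[OF k w]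
    by (elim back_subst[of "\<lambda>x. x"]) (intro cong arg_cong2[where f = "(=)"]; simp add: I Ix Iy)
qed

text \<open>The contribution of the two traces \<open>p\<^sup>-\<close>, \<open>p\<^sup>+\<close> of \<open>F u\<close> and \<open>q\<^sup>-\<close>, \<open>q\<^sup>+\<close> of \<open>\<xi>\<close>
  at one interface with numerical fluxes \<open>f\<close> and \<open>g\<close>.\<close>
definition flux_defect :: "'a::real_inner \<Rightarrow> 'a \<Rightarrow> 'a \<Rightarrow> 'a \<Rightarrow> 'a \<Rightarrow> 'a \<Rightarrow> real" where
  "flux_defect f g pm pp qm qp =
     f \<bullet> (qm - qp) + g \<bullet> (pm - pp) - (pm \<bullet> qm - pp \<bullet> qp)"

text \<open>Interface i is the left end of \<open>rcell X i\<close>. Periodicity trades interface 0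
  for the last one, which \<open>rcell\<close> sends back to cell 1.\<close>

lemma sum_periodic_shift:
  assumes "ncells X \<ge> 1" "g 0 1 = g (ncells X) 1"
  shows "(\<Sum>i=1..ncells X. g (i - 1) i) = (\<Sum>i=1..ncells X. g i (rcell X i) :: real)"
proof -
  obtain n where n: "ncells X = Suc n" using assms(1) by (cases "ncells X") auto
  have "(\<Sum>i=1..Suc n. g (i - 1) i) = (\<Sum>i=0..n. g i (Suc i))"
    using sum.shift_bounds_cl_Suc_ivl[of "\<lambda>i. g (i - 1) i" 0 n] by simp
  also have "\<dots> = g 0 1 + (\<Sum>i=1..n. g i (Suc i))"
    by (simp add: sum.atLeast_Suc_atMost)
  also have "(\<Sum>i=1..n. g i (Suc i)) = (\<Sum>i=1..n. g i (rcell X i))"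
    by (intro sum.cong refl) (auto simp: rcell_def n)
  finally show ?thesis using assms(2) by (simp add: n rcell_def)
qed

text \<open>Right-end terms of cell i already sit at interface i; only the left-end terms, with
  fluxes of index i - 1, are shifted. The subtracted products are what summation by parts leaves at
  the cell ends.\<close>

lemma sum_cell_boundary:
  fixes f g :: "nat \<Rightarrow> 'a::real_inner"
  assumes N: "ncells X \<ge> 1" and per: "f 0 = f (ncells X)" "g 0 = g (ncells X)"
  shows "(\<Sum>i=1..ncells X. (f i \<bullet> qr i - f (i - 1) \<bullet> ql i) + (g i \<bullet> pr i - g (i - 1) \<bullet> pl i)
        - (pr i \<bullet> qr i - pl i \<bullet> ql i)) =
    (\<Sum>i=1..ncells X. flux_defect (f i) (g i)
        (pr (lcell X i)) (pl (rcell X i)) (qr (lcell X i)) (ql (rcell X i)))"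
proof -
  define G where "G a i = f a \<bullet> ql i + g a \<bullet> pl i - pl i \<bullet> ql i" for a i
  define H where "H i = f i \<bullet> qr i + g i \<bullet> pr i - pr i \<bullet> qr i" for i
  have "(\<Sum>i=1..ncells X. (f i \<bullet> qr i - f (i - 1) \<bullet> ql i) + (g i \<bullet> pr i - g (i - 1) \<bullet> pl i)
        - (pr i \<bullet> qr i - pl i \<bullet> ql i)) = (\<Sum>i=1..ncells X. H i) - (\<Sum>i=1..ncells X. G (i - 1) i)"
    unfolding sum_subtractf[symmetric] by (intro sum.cong refl) (simp add: G_def H_def)
  also have "(\<Sum>i=1..ncells X. G (i - 1) i) = (\<Sum>i=1..ncells X. G i (rcell X i))"
    using N by (rule sum_periodic_shift) (simp add: G_def per)
  also have "(\<Sum>i=1..ncells X. H i) - \<dots> = (\<Sum>i=1..ncells X. flux_defect (f i) (g i)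
        (pr (lcell X i)) (pl (rcell X i)) (qr (lcell X i)) (ql (rcell X i)))"
    unfolding sum_subtractf[symmetric]
    by (intro sum.cong refl) (auto simp: G_def H_def flux_defect_def lcell_def inner_diff_right)
  finally show ?thesis .
qed

text \<open>The fluxes are arbitrary up to periodicity, so both flux choices are instances and
  differ only in the value of \<open>flux_defect\<close>.\<close>

lemma dg_entropy_balance:
  assumes k: "k \<ge> 1" and X: "is_mesh X" and Y: "is_mesh Y"
    and scheme: "dg_scheme k X Y F \<xi> Fux Fuy \<xi>x \<xi>y \<rho>t \<rho> ux uy"
    and per: "Fux 0 = Fux (ncells X)" "\<xi>x 0 = \<xi>x (ncells X)"
      "\<And>i. Fuy i 0 = Fuy i (ncells Y)" "\<And>i. \<xi>y i 0 = \<xi>y i (ncells Y)"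
  defines "P \<equiv> mat_app F \<rho> ux" and "Q \<equiv> mat_app F \<rho> uy" and "\<Xi> \<equiv> at_states \<xi> \<rho>"
  shows "mesh_quad2 k X Y (\<lambda>i j x y. \<rho>t i j x y \<bullet> \<Xi> i j x y) =
    - mesh_quad2 k X Y (\<lambda>i j x y. ux i j x y \<bullet> P i j x y + uy i j x y \<bullet> Q i j x y)
    + (\<Sum>i=1..ncells X. mesh_quad k Y (\<lambda>j y. flux_defect (Fux i j y) (\<xi>x i j y)
        (xm X P i j y) (xp X P i j y) (xm X \<Xi> i j y) (xp X \<Xi> i j y)))
    + (\<Sum>j=1..ncells Y. mesh_quad k X (\<lambda>i x. flux_defect (Fuy i j x) (\<xi>y i j x)
        (ym Y Q i j x) (yp Y Q i j x) (ym Y \<Xi> i j x) (yp Y \<Xi> i j x)))"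
proof -
  have N: "ncells X \<ge> 1" "ncells Y \<ge> 1" using X Y by (auto simp: is_mesh_def)
  \<comment> \<open>Boundary terms of the first equation tested with \<open>\<Xi>\<close>, plus
    those of the second tested with \<open>P\<close>, minus those produced by summation by
    parts.\<close>
  define Bx where "Bx i j y = (Fux i j y \<bullet> \<Xi> i j (rpt X i) y - Fux (i - 1) j y \<bullet> \<Xi> i j (lpt X i) y)
      + (\<xi>x i j y \<bullet> P i j (rpt X i) y - \<xi>x (i - 1) j y \<bullet> P i j (lpt X i) y)
      - (P i j (rpt X i) y \<bullet> \<Xi> i j (rpt X i) y - P i j (lpt X i) y \<bullet> \<Xi> i j (lpt X i) y)" for i j y
  define By where "By i j x = (Fuy i j x \<bullet> \<Xi> i j x (rpt Y j) - Fuy i (j - 1) x \<bullet> \<Xi> i j x (lpt Y j))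
      + (\<xi>y i j x \<bullet> Q i j x (rpt Y j) - \<xi>y i (j - 1) x \<bullet> Q i j x (lpt Y j))
      - (Q i j x (rpt Y j) \<bullet> \<Xi> i j x (rpt Y j) - Q i j x (lpt Y j) \<bullet> \<Xi> i j x (lpt Y j))" for i j x
  have cell: "cell_quad2 k X Y i j (\<lambda>x y. \<rho>t i j x y \<bullet> \<Xi> i j x y) =
      - cell_quad2 k X Y i j (\<lambda>x y. ux i j x y \<bullet> P i j x y + uy i j x y \<bullet> Q i j x y)
      + cell_quad k Y j (Bx i j) + cell_quad k X i (By i j)"
    if i: "i \<in> {1..ncells X}" and j: "j \<in> {1..ncells Y}" for i j
  proof -
    have w: "cell_width X i \<noteq> 0" "cell_width Y j \<noteq> 0"
      using is_mesh_cell_width[OF X i] is_mesh_cell_width[OF Y j] by auto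
    \<comment> \<open>The volume terms of the two tested equations pair up into one discrete product
      rule per direction.\<close>
    have "cell_quad2 k X Y i j (\<lambda>x y. P i j x y \<bullet> qdx k X Y \<Xi> i j x y + Q i j x y \<bullet> qdy k X Y \<Xi> i j x y)
      + cell_quad2 k X Y i j (\<lambda>x y. \<Xi> i j x y \<bullet> (qdx k X Y P i j x y + qdy k X Y Q i j x y))
      = cell_quad2 k X Y i j (\<lambda>x y. P i j x y \<bullet> qdx k X Y \<Xi> i j x y + \<Xi> i j x y \<bullet> qdx k X Y P i j x y)
      + cell_quad2 k X Y i j (\<lambda>x y. Q i j x y \<bullet> qdy k X Y \<Xi> i j x y + \<Xi> i j x y \<bullet> qdy k X Y Q i j x y)"
      by (simp add: inner_add_right cell_quad2_add)
    also have "cell_quad2 k X Y i j (\<lambda>x y. P i j x y \<bullet> qdx k X Y \<Xi> i j x y + \<Xi> i j x y \<bullet> qdx k X Y P i j x y)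
      = cell_quad k Y j (\<lambda>y. P i j (rpt X i) y \<bullet> \<Xi> i j (rpt X i) y - P i j (lpt X i) y \<bullet> \<Xi> i j (lpt X i) y)"
      unfolding cell_quad2_def by (intro cell_quad_cong cell_quad_sbp_x[OF k w refl])
    also have "cell_quad2 k X Y i j (\<lambda>x y. Q i j x y \<bullet> qdy k X Y \<Xi> i j x y + \<Xi> i j x y \<bullet> qdy k X Y Q i j x y)
      = cell_quad k X i (\<lambda>x. Q i j x (rpt Y j) \<bullet> \<Xi> i j x (rpt Y j) - Q i j x (lpt Y j) \<bullet> \<Xi> i j x (lpt Y j))"
      \<comment> \<open>\<open>cell_quad2\<close> has the x rule inside, whereas summation by parts
        in y needs the y rule inside.\<close>
      unfolding cell_quad2_def
      by (subst cell_quad_swap) (intro cell_quad_cong cell_quad_sbp_y[OF k w refl])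
    finally show ?thesis
      using dg_scheme_test(1)[OF k X Y scheme i j, of \<Xi>]
        dg_scheme_test(2)[OF k X Y scheme i j, of P Q, folded \<Xi>_def]
      unfolding Bx_def By_def P_def[symmetric] Q_def[symmetric] cell_quad_add cell_quad_diff by linarith
  qed
  have "mesh_quad2 k X Y (\<lambda>i j x y. \<rho>t i j x y \<bullet> \<Xi> i j x y) =
    (\<Sum>i=1..ncells X. \<Sum>j=1..ncells Y.
      - cell_quad2 k X Y i j (\<lambda>x y. ux i j x y \<bullet> P i j x y + uy i j x y \<bullet> Q i j x y)
      + cell_quad k Y j (Bx i j) + cell_quad k X i (By i j))"
    unfolding mesh_quad2_cells by (intro sum.cong refl cell)
  also have "\<dots> = - mesh_quad2 k X Y (\<lambda>i j x y. ux i j x y \<bullet> P i j x y + uy i j x y \<bullet> Q i j x y)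
    + (\<Sum>i=1..ncells X. \<Sum>j=1..ncells Y. cell_quad k Y j (Bx i j))
    + (\<Sum>i=1..ncells X. \<Sum>j=1..ncells Y. cell_quad k X i (By i j))"
    by (simp only: mesh_quad2_cells sum.distrib sum_negf)
  also have "(\<Sum>i=1..ncells X. \<Sum>j=1..ncells Y. cell_quad k Y j (Bx i j))
    = (\<Sum>i=1..ncells X. mesh_quad k Y (\<lambda>j y. flux_defect (Fux i j y) (\<xi>x i j y)
        (xm X P i j y) (xp X P i j y) (xm X \<Xi> i j y) (xp X \<Xi> i j y)))"
    \<comment> \<open>For fixed j and y the sum over i follows one periodic grid line.\<close>
    unfolding mesh_quad_def sum.swap[of _ "{1..ncells Y}"] unfolding cell_quad_sum[symmetric]
      Bx_def xm_def xp_def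
    by (intro sum.cong refl arg_cong[where f = "cell_quad _ _ _"] ext
        sum_cell_boundary[OF N(1), where f = "\<lambda>i. Fux i _ _" and g = "\<lambda>i. \<xi>x i _ _"])
      (simp_all add: per)
  also have "(\<Sum>i=1..ncells X. \<Sum>j=1..ncells Y. cell_quad k X i (By i j))
    = (\<Sum>j=1..ncells Y. mesh_quad k X (\<lambda>i x. flux_defect (Fuy i j x) (\<xi>y i j x)
        (ym Y Q i j x) (yp Y Q i j x) (ym Y \<Xi> i j x) (yp Y \<Xi> i j x)))"
    unfolding mesh_quad_def sum.swap[of _ "{1..ncells X}"] unfolding cell_quad_sum[symmetric]
      By_def ym_def yp_def
    by (intro sum.cong refl arg_cong[where f = "cell_quad _ _ _"] ext
        sum_cell_boundary[OF N(2), where f = "\<lambda>j. Fuy _ j _" and g = "\<lambda>j. \<xi>y _ j _"])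
      (simp_all add: per)
  finally show ?thesis .
qed

text \<open>The jump of a product is average times jump plus jump times average, so the central
  parts cancel and only the penalty is left.\<close>

lemma flux_defect_central:
  "flux_defect ((1 / 2) *\<^sub>R (pp + pm) + (a / 2) *\<^sub>R d) ((1 / 2) *\<^sub>R (qp + qm)) pm pp qm qp
    = - (1 / 2) * (a * ((qp - qm) \<bullet> d))"
  by (simp add: flux_defect_def inner_simps inner_commute field_simps)

text \<open>The jump of the product also splits as
  \<open>pp \<bullet> (qp - qm) + (pp - pm) \<bullet> qm\<close>, or with the sides exchanged; each
  flux pair matches one splitting.\<close>

lemma flux_defect_alternating:
  "flux_defect pp qm pm pp qm qp = 0" "flux_defect pm qp pm pp qm qp = 0"
  by (simp_all add: flux_defect_def inner_simps inner_commute)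

section \<open>The entropy variable of a convex entropy\<close>

text \<open>A derivative within \<open>D\<close> need not be unique, and \<open>entropy_var\<close>
  fixes one choice. Any choice works along a curve that stays in \<open>D\<close>, because
  composition uses the derivative only within the image of the curve.\<close>

lemma entropy_var_chain:
  fixes e :: "real ^ 'm \<Rightarrow> real"
  assumes e: "e differentiable_on D" and cD: "\<And>s. s \<in> T \<Longrightarrow> c s \<in> D" and t: "t \<in> T"
    and c: "(c has_vector_derivative v) (at t within T)"
  shows "((\<lambda>s. e (c s)) has_real_derivative v \<bullet> entropy_var e D (c t)) (at t within T)"
proof -
  define f where "f = frechet_derivative e (at (c t) within D)"
  have f: "(e has_derivative f) (at (c t) within D)"
    using e cD[OF t] unfolding f_def differentiable_on_def frechet_derivative_works by blast
  then have "(e has_derivative f) (at (c t) within c ` T)"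
    using cD by (auto intro: has_derivative_subset)
  with c have "((\<lambda>s. e (c s)) has_derivative (\<lambda>h. f (h *\<^sub>R v))) (at t within T)"
    unfolding has_vector_derivative_def by (rule has_derivative_in_compose)
  moreover have lin: "linear f" using f by (rule has_derivative_linear)
  moreover have "f v = v \<bullet> entropy_var e D (c t)"
  proof -
    have "f v = f (\<Sum>l\<in>UNIV. v $ l *\<^sub>R axis l 1)"
      using basis_expansion[of v] by (simp add: scalar_mult_eq_scaleR)
    also have "\<dots> = (\<Sum>l\<in>UNIV. v $ l * f (axis l 1))"
      using lin by (simp add: linear_sum linear_scale)
    finally show ?thesis by (simp add: inner_vec_def entropy_var_def f_def)
  qed
  ultimately show ?thesis
    by (simp add: has_field_derivative_def linear_scale mult_commute_abs)
qed

text \<open>Convexity bounds the difference quotients of \<open>e\<close> along the segment from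
  \<open>p\<close> to \<open>q\<close> by \<open>e q - e p\<close>. The limit at 0 is one-sided, as
  the line may leave \<open>D\<close> for negative \<open>s\<close>.\<close>

lemma entropy_var_gradient_inequality:
  fixes e :: "real ^ 'm \<Rightarrow> real"
  assumes D: "convex D" and cvx: "convex_on D e" and e: "e differentiable_on D"
    and p: "p \<in> D" and q: "q \<in> D"
  shows "(q - p) \<bullet> entropy_var e D p \<le> e q - e p"
proof -
  define c where "c s = p + s *\<^sub>R (q - p)" for s :: real
  have c: "c s = (1 - s) *\<^sub>R p + s *\<^sub>R q" for s by (simp add: c_def algebra_simps)
  have cD: "c s \<in> D" if "s \<in> {0..1}" for s
    using D p q that unfolding c convex_alt by auto
  have "(c has_vector_derivative (q - p)) (at 0 within {0..1})"
    unfolding c_def by (auto intro!: derivative_eq_intros)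
  from entropy_var_chain[OF e cD _ this]
  have "((\<lambda>s. e (c s)) has_real_derivative (q - p) \<bullet> entropy_var e D p) (at 0 within {0..1})"
    by (simp add: c_def)
  then have lim: "((\<lambda>s. (e (c s) - e p) / s) \<longlongrightarrow> (q - p) \<bullet> entropy_var e D p) (at 0 within {0..1})"
    by (simp add: has_field_derivative_iff c_def)
  have "\<forall>\<^sub>F s in at 0 within {0..1}. (e (c s) - e p) / s \<le> e q - e p"
    unfolding eventually_at_filter
  proof (intro always_eventually allI impI)
    fix s :: real assume s: "s \<noteq> 0" "s \<in> {0..1}"
    then have "e (c s) \<le> (1 - s) * e p + s * e q"
      unfolding c using convex_onD[OF cvx _ _ p q, of s] by auto
    then show "(e (c s) - e p) / s \<le> e q - e p" using s by (simp add: field_simps)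
  qed
  \<comment> \<open>The bound passes to the limit because the filter is nontrivial: it is
    \<open>at_right 0\<close>.\<close>
  from tendsto_upperbound[OF lim this] show ?thesis
    by (simp add: at_within_Icc_at_right)
qed

text \<open>Add the gradient inequalities at \<open>p\<close> and at \<open>q\<close>.\<close>

lemma entropy_var_monotone:
  fixes e :: "real ^ 'm \<Rightarrow> real"
  assumes "convex D" "convex_on D e" "e differentiable_on D" "p \<in> D" "q \<in> D"
  shows "(entropy_var e D q - entropy_var e D p) \<bullet> (q - p) \<ge> 0"
  using entropy_var_gradient_inequality[OF assms(1-5)] entropy_var_gradient_inequality[OF assms(1-3,5,4)]
  by (simp add: inner_simps inner_commute)

section \<open>Entropy dissipation\<close>

lemma mesh_quad_cmult: "mesh_quad k X (\<lambda>i x. c * f i x) = c * mesh_quad k X f"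
  by (simp add: mesh_quad_def cell_quad_cmult sum_distrib_left)

lemma mesh_quad_nonneg:
  assumes "k \<ge> 1" "is_mesh X"
    and "\<And>i x. i \<in> {1..ncells X} \<Longrightarrow> x \<in> {lpt X i..rpt X i} \<Longrightarrow> f i x \<ge> 0"
  shows "mesh_quad k X f \<ge> 0"
  unfolding mesh_quad_def using assms
  by (intro sum_nonneg cell_quad_nonneg is_mesh_cell_width) auto

lemma mesh_quad_deriv:
  assumes "k \<ge> 1" "is_mesh X"
    and "\<And>i x. i \<in> {1..ncells X} \<Longrightarrow> x \<in> {lpt X i..rpt X i} \<Longrightarrow>
      ((\<lambda>s. f s i x) has_real_derivative f' i x) (at t within T)"
  shows "((\<lambda>s. mesh_quad k X (f s)) has_real_derivative mesh_quad k X f') (at t within T)"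
  unfolding mesh_quad_def cell_quad_def using assms
  by (intro DERIV_sum DERIV_cmult assms(3) cell_node_in_cell is_mesh_cell_width) auto

lemma rcell_in_cells: "is_mesh X \<Longrightarrow> i \<in> {1..ncells X} \<Longrightarrow> rcell X i \<in> {1..ncells X}"
  by (auto simp: rcell_def is_mesh_def)

lemma lcell_in_cells: "is_mesh X \<Longrightarrow> i \<in> {1..ncells X} \<Longrightarrow> lcell X i \<in> {1..ncells X}"
  by (auto simp: lcell_def is_mesh_def)

lemma cell_endpoints:
  assumes "is_mesh X" "i \<in> {1..ncells X}"
  shows "lpt X i \<in> {lpt X i..rpt X i}" "rpt X i \<in> {lpt X i..rpt X i}"
  using is_mesh_cell_width[OF assms] by (auto simp: cell_width_def)

text \<open>\<open>lcell\<close> and \<open>rcell\<close> give interface 0 and the last interface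
  the same two neighbours, so periodicity is built into the traces and hence the fluxes.\<close>

lemma x_traces_periodic: "xm X v 0 = xm X v (ncells X)" "xp X v 0 = xp X v (ncells X)"
  by (auto simp: xm_def xp_def lcell_def rcell_def fun_eq_iff)

lemma y_traces_periodic: "ym Y v i 0 = ym Y v i (ncells Y)" "yp Y v i 0 = yp Y v i (ncells Y)"
  by (auto simp: ym_def yp_def lcell_def rcell_def fun_eq_iff)

lemma central_fluxes_periodic:
  "avg_x X v 0 = avg_x X v (ncells X)" "avg_y Y v i 0 = avg_y Y v i (ncells Y)"
  "lf_flux_x X F G \<rho> u 0 = lf_flux_x X F G \<rho> u (ncells X)"
  "lf_flux_y Y F G \<rho> u i 0 = lf_flux_y Y F G \<rho> u i (ncells Y)"
  by (simp_all add: fun_eq_iff avg_x_def avg_y_def lf_flux_x_def lf_flux_y_def alpha_x_def alpha_y_def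
      jump_x_def jump_y_def x_traces_periodic y_traces_periodic)

lemma alpha_nonneg: "alpha_x X G \<rho> u i j y \<ge> 0" "alpha_y Y G \<rho> u i j x \<ge> 0"
  by (simp_all add: alpha_x_def alpha_y_def infnorm_pos_le le_max_iff_disj)

lemma central_lf_balance:
  assumes "k \<ge> 1" "is_mesh X" "is_mesh Y"
    and "central_lf_scheme k X Y F G \<xi> \<rho>t \<rho> ux uy"
  shows "mesh_quad2 k X Y (\<lambda>i j x y. \<rho>t i j x y \<bullet> at_states \<xi> \<rho> i j x y) =
    - mesh_quad2 k X Y (\<lambda>i j x y.
        ux i j x y \<bullet> mat_app F \<rho> ux i j x y + uy i j x y \<bullet> mat_app F \<rho> uy i j x y)
    - 1 / 2 * (\<Sum>i=1..ncells X. mesh_quad k Y (\<lambda>j y.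
        alpha_x X G \<rho> ux i j y * (jump_x X (at_states \<xi> \<rho>) i j y \<bullet> jump_x X \<rho> i j y)))
    - 1 / 2 * (\<Sum>j=1..ncells Y. mesh_quad k X (\<lambda>i x.
        alpha_y Y G \<rho> uy i j x * (jump_y Y (at_states \<xi> \<rho>) i j x \<bullet> jump_y Y \<rho> i j x)))"
  using dg_entropy_balance[OF assms(1-3) assms(4)[unfolded central_lf_scheme_def] central_fluxes_periodic(3,1,4,2)]
  unfolding lf_flux_x_def lf_flux_y_def avg_x_def avg_y_def flux_defect_central
    mesh_quad_cmult jump_x_def[symmetric] jump_y_def[symmetric]
  by (simp add: sum_distrib_left sum_negf)

lemma alternating_balance:
  assumes "k \<ge> 1" "is_mesh X" "is_mesh Y"
    and "alternating_scheme a b k X Y F \<xi> \<rho>t \<rho> ux uy"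
  shows "mesh_quad2 k X Y (\<lambda>i j x y. \<rho>t i j x y \<bullet> at_states \<xi> \<rho> i j x y) =
    - mesh_quad2 k X Y (\<lambda>i j x y.
        ux i j x y \<bullet> mat_app F \<rho> ux i j x y + uy i j x y \<bullet> mat_app F \<rho> uy i j x y)"
proof -
  have zero: "mesh_quad k Z (\<lambda>i x. 0) = 0" for Z
    by (simp add: mesh_quad_def cell_quad_def)
  show ?thesis
    by (subst dg_entropy_balance[OF assms(1-3) assms(4)[unfolded alternating_scheme_def]])
      (simp_all add: x_traces_periodic y_traces_periodic flux_defect_alternating zero)
qed

theorem theorem3p1:
  fixes k :: nat and X Y :: mesh1d
    and D :: "(real ^ ('m::finite)) set"
    and e :: "real ^ 'm \<Rightarrow> real" and \<xi> :: "real ^ 'm \<Rightarrow> real ^ 'm"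
    and F :: "real ^ 'm \<Rightarrow> real ^ 'm ^ 'm"
    and T :: "real set" and \<rho> ux uy :: "real \<Rightarrow> 'm pw_fun"
  assumes "k \<ge> 1" and "is_mesh X" and "is_mesh Y"
    and "convex D" and "convex_on D e" and "e differentiable_on D"
    and "\<xi> = entropy_var e D" and "\<xi> differentiable_on D"
    and "\<And>p z. p \<in> D \<Longrightarrow> z \<bullet> (F p *v z) \<ge> 0"
    and "is_interval T" and "interior T \<noteq> {}"
    and "\<And>t. t \<in> T \<Longrightarrow> \<rho> t \<in> dg_space k X Y"
    and "\<And>t. t \<in> T \<Longrightarrow> ux t \<in> dg_space k X Y"
    and "\<And>t. t \<in> T \<Longrightarrow> uy t \<in> dg_space k X Y"
    and "\<And>t i j x y. \<lbrakk>t \<in> T; i \<in> {1..ncells X}; j \<in> {1..ncells Y};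
           x \<in> {lpt X i..rpt X i}; y \<in> {lpt Y j..rpt Y j}\<rbrakk> \<Longrightarrow>
           \<rho> t i j x y \<in> D \<and> (\<lambda>s. \<rho> s i j x y) differentiable (at t within T)"
  shows
    "(\<forall>G :: real ^ 'm \<Rightarrow> real ^ 'm ^ 'm.
        (\<forall>p\<in>D. diag_matrix p ** G p = F p) \<longrightarrow> bounded (G ` D) \<longrightarrow>
        (\<forall>t\<in>T. central_lf_scheme k X Y F G \<xi> (time_deriv T \<rho> t) (\<rho> t) (ux t) (uy t)) \<longrightarrow>
        (\<forall>t\<in>T.
          let dE =
            - mesh_quad2 k X Y (\<lambda>i j x y.
                  ux t i j x y \<bullet> mat_app F (\<rho> t) (ux t) i j x y
                + uy t i j x y \<bullet> mat_app F (\<rho> t) (uy t) i j x y)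
            - 1 / 2 * (\<Sum>i=1..ncells X. mesh_quad k Y (\<lambda>j y.
                  alpha_x X G (\<rho> t) (ux t) i j y *
                  (jump_x X (at_states \<xi> (\<rho> t)) i j y \<bullet> jump_x X (\<rho> t) i j y)))
            - 1 / 2 * (\<Sum>j=1..ncells Y. mesh_quad k X (\<lambda>i x.
                  alpha_y Y G (\<rho> t) (uy t) i j x *
                  (jump_y Y (at_states \<xi> (\<rho> t)) i j x \<bullet> jump_y Y (\<rho> t) i j x)))
          in ((\<lambda>s. discrete_entropy k X Y e (\<rho> s)) has_real_derivative dE) (at t within T) \<and>
             dE \<le> 0)) \<and>
     (\<forall>upper_x upper_y.
        (\<forall>t\<in>T. alternating_scheme upper_x upper_y k X Y F \<xi>
                  (time_deriv T \<rho> t) (\<rho> t) (ux t) (uy t)) \<longrightarrow>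
        (\<forall>t\<in>T.
          let dE =
            - mesh_quad2 k X Y (\<lambda>i j x y.
                  ux t i j x y \<bullet> mat_app F (\<rho> t) (ux t) i j x y
                + uy t i j x y \<bullet> mat_app F (\<rho> t) (uy t) i j x y)
          in ((\<lambda>s. discrete_entropy k X Y e (\<rho> s)) has_real_derivative dE) (at t within T) \<and>
             dE \<le> 0))"
proof -
  note k = assms(1) and X = assms(2) and Y = assms(3)
  have state: "\<rho> t i j x y \<in> D" if "t \<in> T" "i \<in> {1..ncells X}" "j \<in> {1..ncells Y}"
    "x \<in> {lpt X i..rpt X i}" "y \<in> {lpt Y j..rpt Y j}" for t i j x y
    using assms(15)[OF that] by blast
  \<comment> \<open>Nodes and weights do not depend on time, so the chain rule at each node
    suffices; the result is the left side of the first equation tested with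
    \<open>\<xi>\<close>.\<close>
  have deriv: "((\<lambda>s. discrete_entropy k X Y e (\<rho> s)) has_real_derivative
      mesh_quad2 k X Y (\<lambda>i j x y. time_deriv T \<rho> t i j x y \<bullet> at_states \<xi> (\<rho> t) i j x y)) (at t within T)"
    if t: "t \<in> T" for t
    unfolding discrete_entropy_def mesh_quad2_def at_states_def assms(7)
  proof (intro mesh_quad_deriv k X Y entropy_var_chain assms(6) t state)
    fix i j x y
    assume "j \<in> {1..ncells Y}" "y \<in> {lpt Y j..rpt Y j}" "i \<in> {1..ncells X}" "x \<in> {lpt X i..rpt X i}"
    then show "((\<lambda>s. \<rho> s i j x y) has_vector_derivative time_deriv T \<rho> t i j x y) (at t within T)"
      unfolding time_deriv_def using assms(15)[OF t] by (simp add: vector_derivative_works)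
  qed
  have dissipation: "mesh_quad2 k X Y (\<lambda>i j x y.
      ux t i j x y \<bullet> mat_app F (\<rho> t) (ux t) i j x y
      + uy t i j x y \<bullet> mat_app F (\<rho> t) (uy t) i j x y) \<ge> 0" if t: "t \<in> T" for t
    unfolding mesh_quad2_def mat_app_def
    by (intro mesh_quad_nonneg k X Y add_nonneg_nonneg assms(9) state t)
  \<comment> \<open>The two states at an interface are values on closed neighbouring cells, hence
    lie in \<open>D\<close>, where \<open>entropy_var\<close> is monotone.\<close>
  have jumps_x: "(\<Sum>i=1..ncells X. mesh_quad k Y (\<lambda>j y. alpha_x X G (\<rho> t) (ux t) i j y *
      (jump_x X (at_states \<xi> (\<rho> t)) i j y \<bullet> jump_x X (\<rho> t) i j y))) \<ge> 0" if t: "t \<in> T" for t G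
    unfolding jump_x_def xp_def xm_def at_states_def assms(7)
    by (intro sum_nonneg mesh_quad_nonneg k Y mult_nonneg_nonneg alpha_nonneg
        entropy_var_monotone assms(4-6) state t cell_endpoints X rcell_in_cells lcell_in_cells)
  have jumps_y: "(\<Sum>j=1..ncells Y. mesh_quad k X (\<lambda>i x. alpha_y Y G (\<rho> t) (uy t) i j x *
      (jump_y Y (at_states \<xi> (\<rho> t)) i j x \<bullet> jump_y Y (\<rho> t) i j x))) \<ge> 0" if t: "t \<in> T" for t G
    unfolding jump_y_def yp_def ym_def at_states_def assms(7)
    by (intro sum_nonneg mesh_quad_nonneg k X mult_nonneg_nonneg alpha_nonneg
        entropy_var_monotone assms(4-6) state t cell_endpoints Y rcell_in_cells lcell_in_cells)
  show ?thesis
  proof (intro conjI allI impI ballI, goal_cases)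
    case (1 G t)
    then show ?case
      using deriv[of t] dissipation[of t] jumps_x[of t G] jumps_y[of t G]
        central_lf_balance[OF k X Y, of F G \<xi> "time_deriv T \<rho> t" "\<rho> t" "ux t" "uy t"]
      by (simp add: Let_def)
  next
    case (2 a b t)
    then show ?case
      using deriv[of t] dissipation[of t]
        alternating_balance[OF k X Y, of a b F \<xi> "time_deriv T \<rho> t" "\<rho> t" "ux t" "uy t"]
      by (simp add: Let_def)
  qed
qed

end
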